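(* Let $\mathbb{F}$ be an algebraically closed field, $V=\mathbb{F}^n$, $R=\mathbb{F}[V]$, and let $W\subset \mathrm{GL}(V)$ be a finite group generated by pseudo-reflections with $|W|\in\mathbb{F}^\times$. Then the localization map $$\mu\colon R\otimes_{R^W}R\to \mathrm{Maps}(W,R),\qquad \mu(f\otimes g)(x)=f\cdot x(g)\quad (x\in W),$$ is injective, and its image is equal to the subset $$\mathcal{H}_W=\left\{F\colon W\to R\ \left|\ \sum_{j=0}^{|s|-1}\frac{F(x s^j)}{L_s(x s^j)^i}\in R\ \ \text{for all } x\in W,\ \text{all } s\in s(W),\ \text{and all integers } i\le |s|-1\right.\right\}.$$
   Context: $R=\mathbb{F}[V]$ is the ring of polynomial functions on $V$; $W$ acts on $R$ by $(w\cdot f)(v)=f(w^{-1}v)$, and $w(f)$ denotes $w\cdot f$. $R^W\subset R$ is the subring of $W$-invariants. $\mathrm{Maps}(W,R)$ is the ring of all maps $W\to R$ with pointwise operations, identified with $\bigoplus_{x\in W}R$. A pseudo-reflection is a non-identity element $s\in W$ whose fixed subspace in $V$ is a hyperplane $H_s$; $s(W)$ is the set of all pseudo-reflections in $W$, and $|s|$ is the order of $s$. For each $s\in s(W)$ a co-root $\ell_s\in V^*$ is chosen and fixed, i.e. a non-zero linear function vanishing on $H_s$, and $L_s\colon W\to R$ is defined by $L_s(x)=x(\ell_s)$. The sums defining $\mathcal{H}_W$ are taken in the field of fractions $\mathrm{Quot}(R)$. *)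

theory Defs
  imports
    "HOL-Analysis.Determinants"
    "HOL-Algebra.Free_Abelian_Groups"
    "HOL-Algebra.Generated_Groups"
    "HOL-Algebra.Multiplicative_Group"
    "HOL-Computational_Algebra.Polynomial_Factorial"
begin

section \<open>The ring of polynomial functions on the space of column vectors\<close>

inductive_set poly_funs :: "('a::field ^ 'n \<Rightarrow> 'a) set" where
  const: "(\<lambda>v. c) \<in> poly_funs"
| coord: "(\<lambda>v. v $ k) \<in> poly_funs"
| add: "f \<in> poly_funs \<Longrightarrow> g \<in> poly_funs \<Longrightarrow> (\<lambda>v. f v + g v) \<in> poly_funs"
| mult: "f \<in> poly_funs \<Longrightarrow> g \<in> poly_funs \<Longrightarrow> (\<lambda>v. f v * g v) \<in> poly_funs"

typedef (overloaded) ('a::field, 'n::finite) polyfun = "poly_funs :: ('a ^ 'n \<Rightarrow> 'a) set"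
  morphisms eval Polyfun
  using poly_funs.const by blast

setup_lifting type_definition_polyfun

lemma eval_inject_iff: "f = g \<longleftrightarrow> (\<forall>v. eval f v = eval g v)"
  by (metis eval_inject ext)

instantiation polyfun :: (field, finite) comm_ring_1
begin

lift_definition zero_polyfun :: "('a, 'b) polyfun" is "\<lambda>v. 0" by (rule poly_funs.const)
lift_definition one_polyfun :: "('a, 'b) polyfun" is "\<lambda>v. 1" by (rule poly_funs.const)
lift_definition plus_polyfun :: "('a, 'b) polyfun \<Rightarrow> ('a, 'b) polyfun \<Rightarrow> ('a, 'b) polyfun"
  is "\<lambda>f g v. f v + g v" by (rule poly_funs.add)
lift_definition times_polyfun :: "('a, 'b) polyfun \<Rightarrow> ('a, 'b) polyfun \<Rightarrow> ('a, 'b) polyfun"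
  is "\<lambda>f g v. f v * g v" by (rule poly_funs.mult)
lift_definition uminus_polyfun :: "('a, 'b) polyfun \<Rightarrow> ('a, 'b) polyfun"
  is "\<lambda>f v. - f v" using poly_funs.mult[OF poly_funs.const[of "-1"]] by simp
lift_definition minus_polyfun :: "('a, 'b) polyfun \<Rightarrow> ('a, 'b) polyfun \<Rightarrow> ('a, 'b) polyfun"
  is "\<lambda>f g v. f v - g v"
  using poly_funs.add poly_funs.mult[OF poly_funs.const[of "-1"]] by fastforce

instance
proof
  show "(0 :: ('a, 'b) polyfun) \<noteq> 1" by transfer (simp add: fun_eq_iff)
qed (transfer; simp add: algebra_simps)+

end

lemma poly_funs_on_line:
  assumes "f \<in> poly_funs"
  shows "\<exists>p. \<forall>t. f (u + t *s d) = poly p t"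
  using assms
proof (induction rule: poly_funs.induct)
  case (const c)
  show ?case by (rule exI[of _ "[:c:]"]) simp
next
  case (coord k)
  show ?case by (rule exI[of _ "[:u $ k, d $ k:]"]) simp
next
  case (add f g)
  then show ?case by (metis poly_add)
next
  case (mult f g)
  then show ?case by (metis poly_mult)
qed

text \<open>Over an infinite field a product of non-zero polynomial functions is non-zero: restrict
  both factors to the line through two points at which they do not vanish.\<close>

lemma ex_poly_nonzero:
  fixes p :: "'a::alg_closed_field poly"
  assumes "p \<noteq> 0"
  shows "\<exists>t. poly p t \<noteq> 0"
proof (rule ccontr)
  assume "\<nexists>t. poly p t \<noteq> 0"
  then have z: "poly p t = 0" for t by blast
  have "degree (p * [:0, 1:] + 1) > 0"
  proof -
    have "degree (p * [:0, 1:]) = degree p + 1"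
      using assms by (simp add: degree_mult_eq)
    then show ?thesis by (simp add: degree_add_eq_left)
  qed
  then obtain t where "poly (p * [:0, 1:] + 1) t = 0"
    using alg_closed_imp_poly_has_root by blast
  with z show False by simp
qed

instance polyfun :: (alg_closed_field, finite) idom
proof
  fix f g :: "('a, 'b) polyfun"
  assume "f \<noteq> 0" "g \<noteq> 0"
  then obtain u w where u: "eval f u \<noteq> 0" and w: "eval g w \<noteq> 0"
    by (auto simp: eval_inject_iff zero_polyfun.rep_eq)
  obtain p where p: "\<And>t. eval f (u + t *s (w - u)) = poly p t"
    using poly_funs_on_line[OF eval] by blast
  obtain q where q: "\<And>t. eval g (u + t *s (w - u)) = poly q t"
    using poly_funs_on_line[OF eval] by blast
  have "poly p 0 \<noteq> 0" using p[of 0] u by simp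
  moreover have "poly q 1 \<noteq> 0" using q[of 1] w by simp
  ultimately have "p * q \<noteq> 0" by auto
  then obtain t where "poly (p * q) t \<noteq> 0" using ex_poly_nonzero by blast
  then have "eval (f * g) (u + t *s (w - u)) \<noteq> 0"
    by (simp add: times_polyfun.rep_eq p q)
  then show "f * g \<noteq> 0" by (metis zero_polyfun.rep_eq)
qed


section \<open>The general linear group and its action\<close>

definition GL :: "('a::field ^ 'n ^ 'n) monoid" where
  "GL = \<lparr>carrier = {A. invertible A}, monoid.mult = (**), one = mat 1\<rparr>"

lemma group_GL: "group (GL :: ('a::field ^ 'n ^ 'n) monoid)"
proof (rule groupI)
  fix A :: "'a ^ 'n ^ 'n"
  assume "A \<in> carrier GL"
  then obtain B where B: "A ** B = mat 1" "B ** A = mat 1"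
    by (auto simp: GL_def invertible_def)
  then have "B \<in> carrier GL" by (auto simp: GL_def invertible_def)
  with B show "\<exists>B\<in>carrier GL. B \<otimes>\<^bsub>GL\<^esub> A = \<one>\<^bsub>GL\<^esub>" by (auto simp: GL_def)
qed (auto simp: GL_def matrix_mul_assoc invertible_mult invertible_def[of "mat 1"])

lemma poly_funs_matrix_comp:
  assumes "f \<in> poly_funs"
  shows "(\<lambda>v. f (A *v v)) \<in> poly_funs"
  using assms
proof (induction rule: poly_funs.induct)
  case (coord k)
  have "(\<lambda>v. \<Sum>j\<in>J. A $ k $ j * v $ j) \<in> poly_funs" if "finite J" for J
    using that
  proof (induction rule: finite_induct)
    case empty
    show ?case by (simp add: poly_funs.const)
  next
    case (insert i J)
    have "(\<lambda>v. A $ k $ i * v $ i) \<in> poly_funs"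
      by (rule poly_funs.mult[OF poly_funs.const poly_funs.coord])
    from poly_funs.add[OF this insert.IH] insert.hyps show ?case by simp
  qed
  then show ?case by (simp add: matrix_vector_mult_def)
qed (auto intro: poly_funs.intros)

lift_definition act :: "'a::field ^ 'n ^ 'n \<Rightarrow> ('a, 'n) polyfun \<Rightarrow> ('a, 'n) polyfun"
  is "\<lambda>w f v. f (inv\<^bsub>GL\<^esub> w *v v)"
  by (rule poly_funs_matrix_comp)

lemma act_add: "act w (f + g) = act w f + act w g"
  by transfer simp

lemma act_mult: "act w (f * g) = act w f * act w g"
  by transfer simp

lemma act_one [simp]: "act \<one>\<^bsub>GL\<^esub> f = f"
  by (simp add: eval_inject_iff act.rep_eq monoid.inv_one[OF group.is_monoid[OF group_GL]])
     (simp add: GL_def)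

lemma act_act:
  assumes "x \<in> carrier GL" "y \<in> carrier GL"
  shows "act (x \<otimes>\<^bsub>GL\<^esub> y) f = act x (act y f)"
  using assms
  by (simp add: eval_inject_iff act.rep_eq group.inv_mult_group[OF group_GL])
     (simp add: GL_def matrix_vector_mul_assoc)

definition invariants :: "('a::field ^ 'n ^ 'n) set \<Rightarrow> ('a, 'n) polyfun set" where
  "invariants W = {f. \<forall>w\<in>W. act w f = f}"


section \<open>Pseudo-reflections and co-roots\<close>

definition fixed_space :: "'a::field ^ 'n ^ 'n \<Rightarrow> ('a ^ 'n) set" where
  "fixed_space s = {v. s *v v = v}"

definition is_hyperplane :: "('a::field ^ 'n) set \<Rightarrow> bool" where
  "is_hyperplane H \<longleftrightarrow> vec.subspace H \<and> vec.dim H + 1 = CARD('n)"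

definition pseudo_reflections :: "('a::field ^ 'n ^ 'n) set \<Rightarrow> ('a ^ 'n ^ 'n) set" where
  "pseudo_reflections W = {s \<in> W. s \<noteq> \<one>\<^bsub>GL\<^esub> \<and> is_hyperplane (fixed_space s)}"

definition is_coroot :: "'a::field ^ 'n ^ 'n \<Rightarrow> ('a, 'n) polyfun \<Rightarrow> bool" where
  "is_coroot s l \<longleftrightarrow>
     Vector_Spaces.linear (*s) (*) (eval l) \<and> l \<noteq> 0 \<and> (\<forall>v\<in>fixed_space s. eval l v = 0)"


section \<open>The tensor product of a commutative ring with itself over a subring\<close>

text \<open>The tensor product over \<open>A\<close> is the free abelian group on pairs modulo the subgroup
  generated by the biadditivity and \<open>A\<close>-balancedness relators, so its elements are cosets.\<close>

definition tensor_relators :: "'r::comm_ring_1 set \<Rightarrow> ('r \<times> 'r \<Rightarrow>\<^sub>0 int) set" where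
  "tensor_relators A =
     {frag_of (f + f', g) - frag_of (f, g) - frag_of (f', g) | f f' g. True} \<union>
     {frag_of (f, g + g') - frag_of (f, g) - frag_of (f, g') | f g g'. True} \<union>
     {frag_of (f * a, g) - frag_of (f, a * g) | f a g. a \<in> A}"

definition tensor_kernel :: "'r::comm_ring_1 set \<Rightarrow> ('r \<times> 'r \<Rightarrow>\<^sub>0 int) set" where
  "tensor_kernel A = generate (free_Abelian_group UNIV) (tensor_relators A)"

definition tensor_square :: "'r::comm_ring_1 set \<Rightarrow> ('r \<times> 'r \<Rightarrow>\<^sub>0 int) set monoid" where
  "tensor_square A = free_Abelian_group UNIV Mod tensor_kernel A"

definition pure_tensor :: "'r::comm_ring_1 set \<Rightarrow> 'r \<Rightarrow> 'r \<Rightarrow> ('r \<times> 'r \<Rightarrow>\<^sub>0 int) set" where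
  "pure_tensor A f g = tensor_kernel A #>\<^bsub>free_Abelian_group UNIV\<^esub> frag_of (f, g)"


section \<open>The localization map\<close>

text \<open>\<open>Maps(W,R)\<close> is the set \<open>W \<rightarrow>\<^sub>E UNIV\<close> of extensional functions. The map is first defined
  on formal \<open>\<int>\<close>-linear combinations of pairs and then descends to cosets; the lemmas
  below show that it is well defined, additive, and has the expected value on pure tensors.\<close>

definition localization_lift ::
  "('a::field ^ 'n ^ 'n) set \<Rightarrow> (('a, 'n) polyfun \<times> ('a, 'n) polyfun \<Rightarrow>\<^sub>0 int) \<Rightarrow>
     'a ^ 'n ^ 'n \<Rightarrow> ('a, 'n) polyfun" where
  "localization_lift W c =
     (\<lambda>x\<in>W. \<Sum>(f, g)\<in>Poly_Mapping.keys c. of_int (Poly_Mapping.lookup c (f, g)) * (f * act x g))"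

definition localization_map ::
  "('a::field ^ 'n ^ 'n) set \<Rightarrow> (('a, 'n) polyfun \<times> ('a, 'n) polyfun \<Rightarrow>\<^sub>0 int) set \<Rightarrow>
     'a ^ 'n ^ 'n \<Rightarrow> ('a, 'n) polyfun" where
  "localization_map W T = the_elem (localization_lift W ` T)"

lemma localization_lift_superset:
  assumes "x \<in> W" "finite K" "Poly_Mapping.keys c \<subseteq> K"
  shows "localization_lift W c x =
    (\<Sum>(f, g)\<in>K. of_int (Poly_Mapping.lookup c (f, g)) * (f * act x g))"
  using assms unfolding localization_lift_def
  by (auto intro!: sum.mono_neutral_left simp: in_keys_iff)

lemma localization_lift_add:
  assumes "x \<in> W"
  shows "localization_lift W (c + d) x = localization_lift W c x + localization_lift W d x"
proof -
  let ?K = "Poly_Mapping.keys c \<union> Poly_Mapping.keys d"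
  have "Poly_Mapping.keys (c + d) \<subseteq> ?K" by (rule Poly_Mapping.keys_add)
  then show ?thesis
    using assms
    by (simp add: localization_lift_superset[where K = ?K] lookup_add algebra_simps case_prod_unfold
        flip: sum.distrib)
qed

lemma localization_lift_0: "x \<in> W \<Longrightarrow> localization_lift W 0 x = 0"
  by (simp add: localization_lift_def)

lemma localization_lift_minus:
  assumes "x \<in> W"
  shows "localization_lift W (- c) x = - localization_lift W c x"
  using localization_lift_add[OF assms, of c "- c"] localization_lift_0[OF assms]
  by (simp add: eq_neg_iff_add_eq_0 add.commute)

lemma localization_lift_diff:
  assumes "x \<in> W"
  shows "localization_lift W (c - d) x = localization_lift W c x - localization_lift W d x"
  using localization_lift_add[OF assms, of c "- d"] localization_lift_minus[OF assms] by simp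

lemma localization_lift_frag_of:
  "x \<in> W \<Longrightarrow> localization_lift W (frag_of (f, g)) x = f * act x g"
  by (simp add: localization_lift_def)

lemma localization_lift_tensor_relators:
  assumes "h \<in> tensor_relators (invariants W)" and x: "x \<in> W"
  shows "localization_lift W h x = 0"
proof -
  note lift = localization_lift_diff[OF x] localization_lift_frag_of[OF x]
  from assms(1) consider
      f f' g where "h = frag_of (f + f', g) - frag_of (f, g) - frag_of (f', g)"
    | f g g' where "h = frag_of (f, g + g') - frag_of (f, g) - frag_of (f, g')"
    | f a g where "h = frag_of (f * a, g) - frag_of (f, a * g)" "a \<in> invariants W"
    unfolding tensor_relators_def by blast
  then show ?thesis
  proof cases
    case 1
    then show ?thesis by (simp only: lift) (simp add: algebra_simps)
  next
    case 2
    then show ?thesis by (simp only: lift) (simp add: act_add algebra_simps)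
  next
    case 3
    then have "act x a = a" using x by (simp add: invariants_def)
    with 3(1) show ?thesis by (simp only: lift) (simp add: act_mult algebra_simps)
  qed
qed

lemma localization_lift_tensor_kernel:
  assumes "c \<in> tensor_kernel (invariants W)" and x: "x \<in> W"
  shows "localization_lift W c x = 0"
  using assms(1) unfolding tensor_kernel_def
proof (induction rule: generate.induct)
  case (incl h)
  then show ?case using x by (rule localization_lift_tensor_relators)
next
  case (inv h)
  then show ?case
    using x by (simp add: localization_lift_minus localization_lift_tensor_relators)
qed (use x in \<open>simp_all add: localization_lift_0 localization_lift_add\<close>)

lemma subgroup_tensor_kernel: "subgroup (tensor_kernel A) (free_Abelian_group UNIV)"
  unfolding tensor_kernel_def by (rule group.generate_is_subgroup) auto

lemma normal_tensor_kernel: "tensor_kernel A \<lhd> free_Abelian_group UNIV"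
  by (rule comm_group.normal_iff_subgroup[OF abelian_free_Abelian_group, THEN iffD2])
     (rule subgroup_tensor_kernel)

lemma localization_map_coset:
  "localization_map W (tensor_kernel (invariants W) #>\<^bsub>free_Abelian_group UNIV\<^esub> c) =
     localization_lift W c"
proof -
  have "localization_lift W (k + c) = localization_lift W c"
    if "k \<in> tensor_kernel (invariants W)" for k
  proof (rule ext)
    fix x show "localization_lift W (k + c) x = localization_lift W c x"
      using localization_lift_tensor_kernel[OF that, of x] localization_lift_add[of x W k c]
      by (cases "x \<in> W") (simp_all add: localization_lift_def)
  qed
  moreover have "\<one>\<^bsub>free_Abelian_group UNIV\<^esub> \<in> tensor_kernel (invariants W)"
    by (rule subgroup.one_closed[OF subgroup_tensor_kernel])
  ultimately have
    "localization_lift W ` (tensor_kernel (invariants W) #>\<^bsub>free_Abelian_group UNIV\<^esub> c) =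
       {localization_lift W c}"
    by (auto simp: r_coset_def)
  then show ?thesis by (simp add: localization_map_def)
qed

lemma localization_map_pure_tensor:
  assumes "x \<in> W"
  shows "localization_map W (pure_tensor (invariants W) f g) x = f * act x g"
  using assms by (simp add: pure_tensor_def localization_map_coset localization_lift_frag_of)

lemma localization_map_add:
  assumes "S \<in> carrier (tensor_square (invariants W))"
    and "T \<in> carrier (tensor_square (invariants W))" and "x \<in> W"
  shows "localization_map W (S \<otimes>\<^bsub>tensor_square (invariants W)\<^esub> T) x =
    localization_map W S x + localization_map W T x"
proof -
  obtain c d where
    "S = tensor_kernel (invariants W) #>\<^bsub>free_Abelian_group UNIV\<^esub> c"
    "T = tensor_kernel (invariants W) #>\<^bsub>free_Abelian_group UNIV\<^esub> d"
    using assms by (auto simp: tensor_square_def FactGroup_def RCOSETS_def)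
  then show ?thesis
    using normal.rcos_sum[OF normal_tensor_kernel, of c d "invariants W"] assms(3)
    by (simp add: tensor_square_def FactGroup_def localization_map_coset localization_lift_add)
qed

lemma localization_map_in_Maps:
  assumes "T \<in> carrier (tensor_square (invariants W))"
  shows "localization_map W T \<in> W \<rightarrow>\<^sub>E UNIV"
proof -
  obtain c where "T = tensor_kernel (invariants W) #>\<^bsub>free_Abelian_group UNIV\<^esub> c"
    using assms by (auto simp: tensor_square_def FactGroup_def RCOSETS_def)
  then show ?thesis by (simp add: localization_map_coset localization_lift_def)
qed


section \<open>The subset cut out by the pseudo-reflections\<close>

definition coroot_map ::
  "('a::field ^ 'n ^ 'n \<Rightarrow> ('a, 'n) polyfun) \<Rightarrow> 'a ^ 'n ^ 'n \<Rightarrow> 'a ^ 'n ^ 'n \<Rightarrow> ('a, 'n) polyfun" where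
  "coroot_map l s x = act x (l s)"

text \<open>The exponent \<open>i\<close> ranges over all integers, hence \<open>powi\<close>; the sum lives in the fraction field,
  where \<open>range to_fract\<close> is the copy of the ring of polynomial functions.\<close>

definition H_set ::
  "('a::alg_closed_field ^ 'n ^ 'n) set \<Rightarrow> ('a ^ 'n ^ 'n \<Rightarrow> ('a, 'n) polyfun) \<Rightarrow>
     ('a ^ 'n ^ 'n \<Rightarrow> ('a, 'n) polyfun) set" where
  "H_set W l = {F \<in> W \<rightarrow>\<^sub>E UNIV.
     \<forall>x\<in>W. \<forall>s\<in>pseudo_reflections W. \<forall>i::int. i \<le> int (group.ord GL s) - 1 \<longrightarrow>
       (\<Sum>j<group.ord GL s.
          to_fract (F (x \<otimes>\<^bsub>GL\<^esub> s [^]\<^bsub>GL\<^esub> j)) /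
          to_fract (coroot_map l s (x \<otimes>\<^bsub>GL\<^esub> s [^]\<^bsub>GL\<^esub> j)) powi i) \<in> range to_fract}"

end

theory Submission
  imports Defs
begin

text \<open>The proof is descent along the group action, driven by divided differences. For a
  pseudo-reflection \<open>s\<close> with co-root \<open>l\<^sub>s\<close>, every polynomial function satisfies \<open>s(f) - f \<in> l\<^sub>s R\<close>,
  because \<open>s\<close> fixes the hyperplane \<open>l\<^sub>s = 0\<close> pointwise. Hence \<open>\<Delta>\<^sub>s f = (s(f) - f) / l\<^sub>s\<close> defines an
  \<open>R\<^sup>W\<close>-linear operator on \<open>R\<close> which lowers the degree. Let \<open>W\<close> act on \<open>R \<otimes> R\<close> through the left factor
  and on maps by \<open>(wF)(x) = w(F(w\<inverse>x))\<close>; the localization map is equivariant, and both \<open>\<Delta>\<^sub>s \<otimes> 1\<close> and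
  \<open>F \<mapsto> (sF - F) / l\<^sub>s\<close> make sense.

  Injectivity. Let \<open>c\<close> lie in the kernel. Then \<open>(\<Delta>\<^sub>s \<otimes> 1) c\<close> lies in the kernel, since \<open>l\<^sub>s\<close> is not a
  zero divisor, and its left factors have smaller degree, so by induction it vanishes. Therefore
  \<open>s c = c\<close> for all \<open>s\<close>, hence \<open>w c = c\<close> for all \<open>w \<in> W\<close>, and averaging over \<open>W\<close> moves the left factors
  into \<open>R\<^sup>W\<close>: \<open>c = 1 \<otimes> h\<close>. The value of the localization map at the identity of \<open>W\<close> is \<open>h\<close>, so \<open>h = 0\<close>.
  This is \<open>localization_lift_injective\<close>.

  Surjectivity onto \<open>\<H>\<^sub>W\<close> follows the same pattern: if \<open>F \<in> \<H>\<^sub>W\<close>, then \<open>(sF - F) / l\<^sub>s\<close> is again in \<open>\<H>\<^sub>W\<close>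
  and has smaller degree, so it lies in the image. Modulo the image \<open>F\<close> is thus \<open>W\<close>-invariant and equal
  to its average, and an invariant map has the form \<open>x \<mapsto> x(h)\<close>, the image of \<open>1 \<otimes> h\<close>. This is
  \<open>localization_lift_onto\<close>.

  What remains is that \<open>\<H>\<^sub>W\<close> contains the image and is stable under \<open>F \<mapsto> (sF - F) / l\<^sub>s\<close>. For this
  \<open>\<H>\<^sub>W\<close> is described locally (\<open>H_set_iff_locally_tensor\<close>): \<open>F \<in> \<H>\<^sub>W\<close> iff for every linear form \<open>m\<close>, with
  \<open>W\<^sub>m\<close> the pointwise stabilizer of \<open>m = 0\<close>, the restriction of \<open>F\<close> to each coset \<open>W\<^sub>m x\<close> has the form
  \<open>w x \<mapsto> \<Sum> f\<^sub>i w(g\<^sub>i)\<close>. The group \<open>W\<^sub>m\<close> acts on \<open>m\<close> by a faithful character, so it is cyclic, and the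
  equivalence is Fourier inversion on \<open>W\<^sub>m\<close>: the \<open>i\<close>-th Fourier coefficient of \<open>w \<mapsto> w(g)\<close> is an eigenvector
  and so divisible by \<open>m\<^sup>i\<close>, and conversely coefficients \<open>m\<^sup>i h\<^sub>i\<close> come from the tensor
  \<open>\<Sum> h\<^sub>i \<otimes> m\<^sup>i\<close> up to the scalar \<open>1 / |W\<^sub>m|\<close>. In local form stability is clear when \<open>s \<in> W\<^sub>m\<close>, by applying
  \<open>\<Delta>\<^sub>s \<otimes> 1\<close> to the local tensor; otherwise \<open>l\<^sub>s\<close> and \<open>m\<close> are coprime, and division by \<open>l\<^sub>s\<close> preserves
  divisibility by powers of \<open>m\<close>.\<close>

section \<open>Finite multiplicative subsets of a field\<close>

text \<open>A finite multiplicatively closed set of units in a field is a cyclic group. An element of exact order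
  \<open>d\<close> is built for each divisor \<open>d\<close> of \<open>card X\<close>, splitting off one prime power \<open>p ^ a\<close> at a time:
  since \<open>T ^ k - 1\<close> has at most \<open>k\<close> roots, some element is not killed by \<open>card X div p\<close>, a suitable power
  of it has exact order \<open>p ^ a\<close>, and coprime exact orders multiply.\<close>

lemma exact_order_in_finite_multiplicative_set:
  fixes X :: "'a::field set"
  assumes fin: "finite X" and one: "1 \<in> X" and zero: "0 \<notin> X"
    and mult: "\<And>x y. x \<in> X \<Longrightarrow> y \<in> X \<Longrightarrow> x * y \<in> X"
  shows "\<exists>z\<in>X. \<forall>k. z ^ k = 1 \<longleftrightarrow> card X dvd k"
proof -
  let ?e = "card X"
  have e0: "?e > 0" using fin one card_gt_0_iff by blast
  have pw: "x ^ k \<in> X" if "x \<in> X" for x k by (induct k) (use that one mult in auto)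
  have lagr: "x ^ ?e = 1" if x: "x \<in> X" for x
  proof -
    \<comment> \<open>Lagrange's theorem: multiplication by \<open>x\<close> permutes \<open>X\<close>, so \<open>x ^ card X\<close> cancels from the product over \<open>X\<close>.\<close>
    have inj: "inj_on ((*) x) X" using x zero by (auto simp: inj_on_def)
    have "(*) x ` X = X" using inj fin mult x by (intro endo_inj_surj) auto
    then have "\<Prod>X = prod (\<lambda>y. x * y) X" using prod.reindex[OF inj, of id] by (simp add: o_def)
    also have "\<dots> = x ^ ?e * \<Prod>X" by (simp add: prod.distrib)
    finally show ?thesis using fin zero by auto
  qed
  have nonroot: "\<exists>x\<in>X. x ^ k \<noteq> 1" if "0 < k" "k < ?e" for k
  proof (rule ccontr)
    assume "\<not> ?thesis"
    then have sub: "X \<subseteq> {x. poly (monom 1 k - 1) x = 0}" by (auto simp: poly_monom)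
    have deg: "degree (monom 1 k - 1 :: 'a poly) = k"
    proof -
      have "degree (monom (1::'a) k + (- 1)) = degree (monom (1::'a) k)" using that by (intro degree_add_eq_left) (simp add: degree_monom_eq)
      then show ?thesis by (simp add: degree_monom_eq)
    qed
    then have n0: "(monom 1 k - 1 :: 'a poly) \<noteq> 0" using that by auto
    have "?e \<le> card {x. poly (monom 1 k - 1 :: 'a poly) x = 0}"
      using sub by (intro card_mono poly_roots_finite n0)
    also have "\<dots> \<le> k" using card_poly_roots_bound[OF n0] deg by simp
    finally show False using that by simp
  qed
  have "d dvd ?e \<Longrightarrow> \<exists>z\<in>X. \<forall>k. z ^ k = 1 \<longleftrightarrow> d dvd k" for d
  proof (induction d rule: less_induct)
    case (less d)
    have d0: "d > 0" using less.prems e0 by (auto intro!: Nat.gr0I)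
    show ?case
    proof (cases "d = 1")
      case True
      then show ?thesis by (intro bexI[OF _ one]) auto
    next
      case False
      then obtain p where p: "prime p" "p dvd d" using prime_factor_nat by blast
      define a where "a = multiplicity p d"
      obtain m where m: "d = p ^ a * m" "\<not> p dvd m"
        using multiplicity_decompose'[of d p] p d0 unfolding a_def by (metis neq0_conv not_prime_unit)
      have a0: "a > 0" using p d0 m by (cases a) auto
      have "m < d"
      proof -
        have "m > 0" using m d0 by (auto intro!: Nat.gr0I)
        moreover have "p ^ a > 1" using p a0 by (metis one_less_power prime_gt_1_nat)
        ultimately show ?thesis using m by simp
      qed
      moreover have "m dvd ?e" using less.prems m by (metis dvd_mult_right)
      ultimately obtain x where x: "x \<in> X" "\<And>k. x ^ k = 1 \<longleftrightarrow> m dvd k" using less.IH by metis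
      have cop: "coprime (p ^ a) m" using p m by (simp add: prime_imp_coprime)
      have pe: "p dvd ?e" using p less.prems by (metis dvd_trans)
      have "?e div p < ?e" "0 < ?e div p" using pe e0 p prime_gt_1_nat[OF p(1)]
        by (auto simp: div_greater_zero_iff prime_gt_0_nat dvd_imp_le)
      then obtain z where z: "z \<in> X" "z ^ (?e div p) \<noteq> 1" using nonroot by metis
      have pa: "p ^ a dvd ?e" using less.prems m by (metis dvd_mult_left)
      define y where "y = z ^ (?e div p ^ a)"
      have y1: "y ^ (p ^ a) = 1" using lagr[OF z(1)] pa by (simp add: y_def flip: power_mult)
      have "?e div p ^ a * p ^ (a - 1) = ?e div p"
      proof -
        obtain q where q: "?e = p ^ a * q" using pa by (auto simp: dvd_def)
        have "p ^ a = p * p ^ (a - 1)" using a0 by (cases a) auto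
        then show ?thesis using q p prime_gt_0_nat[OF p(1)] by (simp add: mult.assoc)
      qed
      then have y2: "y ^ (p ^ (a - 1)) \<noteq> 1" using z(2) by (simp add: y_def flip: power_mult)
      have yord: "y ^ k = 1 \<longleftrightarrow> p ^ a dvd k" for k
      proof
        assume k: "y ^ k = 1"
        let ?g = "gcd k (p ^ a)"
        have g: "y ^ ?g = 1"
        proof (cases "k = 0")
          case False
          then obtain u v where uv: "k * u = p ^ a * v + ?g" using bezout_nat by blast
          have "(y ^ k) ^ u = (y ^ (p ^ a)) ^ v * y ^ ?g" by (simp add: uv flip: power_mult power_add)
          then show ?thesis using k y1 by simp
        qed (use y1 in simp)
        obtain b where b: "b \<le> a" "?g = p ^ b" using p(1) by (meson divides_primepow_nat gcd_dvd2)
        have "b = a"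
        proof (rule ccontr)
          assume "b \<noteq> a"
          then have "p ^ (a - 1) = p ^ b * p ^ (a - 1 - b)" using b by (simp flip: power_add)
          then have "y ^ (p ^ (a - 1)) = (y ^ ?g) ^ (p ^ (a - 1 - b))" using b by (simp flip: power_mult)
          then show False using g y2 by simp
        qed
        then show "p ^ a dvd k" using b by (metis gcd_dvd1)
      next
        assume "p ^ a dvd k"
        then show "y ^ k = 1" using y1 by (auto simp: dvd_def power_mult)
      qed
      have "(x * y) ^ k = 1 \<longleftrightarrow> d dvd k" for k
      proof
        assume k: "(x * y) ^ k = 1"
        have "(x * y) ^ (k * p ^ a) = 1" using k by (simp add: power_mult)
        then have "x ^ (k * p ^ a) = 1" using y1 yord[of "k * p ^ a"] by (simp add: power_mult_distrib)
        then have "m dvd k" using x(2) cop by (metis coprime_commute coprime_dvd_mult_left_iff)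
        have "(x * y) ^ (k * m) = 1" using k by (simp add: power_mult)
        then have "y ^ (k * m) = 1" using x(2)[of "k * m"] by (simp add: power_mult_distrib)
        then have "p ^ a dvd k" using yord cop by (metis coprime_dvd_mult_left_iff)
        with \<open>m dvd k\<close> show "d dvd k" using m cop by (metis divides_mult)
      next
        assume "d dvd k"
        then have "m dvd k" "p ^ a dvd k" using m by (auto elim: dvd_mult_left dvd_mult_right)
        then have "x ^ k = 1" "y ^ k = 1" using x(2) yord \<open>m dvd k\<close> \<open>p ^ a dvd k\<close> by blast+
        then show "(x * y) ^ k = 1" by (simp add: power_mult_distrib)
      qed
      moreover have "x * y \<in> X" unfolding y_def by (intro mult pw x z)
      ultimately show ?thesis by blast
    qed
  qed
  from this[OF dvd_refl] show ?thesis .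
qed

section \<open>Polynomial functions\<close>

lemma poly_eq_0_of_values:
  fixes p :: "'a::alg_closed_field poly"
  assumes "\<And>t. t \<noteq> 0 \<Longrightarrow> poly p t = 0"
  shows "p = 0"
proof -
  have "poly ([:0, 1:] * p) t = 0" for t using assms by (cases "t = 0") auto
  then have "[:0, 1:] * p = 0" using ex_poly_nonzero by blast
  then show ?thesis by simp
qed

lift_definition const_fun :: "'a::field \<Rightarrow> ('a, 'n::finite) polyfun" is "\<lambda>c v. c"
  by (rule poly_funs.const)

lemmas eval_simps = zero_polyfun.rep_eq one_polyfun.rep_eq plus_polyfun.rep_eq
  times_polyfun.rep_eq uminus_polyfun.rep_eq minus_polyfun.rep_eq const_fun.rep_eq

lemma eval_power: "eval (f ^ k) v = eval f v ^ k"
  by (induct k) (simp_all add: eval_simps)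

lemma eval_sum: "eval (\<Sum>i\<in>I. f i) v = (\<Sum>i\<in>I. eval (f i) v)"
  by (induct I rule: infinite_finite_induct) (simp_all add: eval_simps)

lemma eval_prod: "eval (\<Prod>i\<in>I. f i) v = (\<Prod>i\<in>I. eval (f i) v)"
  by (induct I rule: infinite_finite_induct) (simp_all add: eval_simps)

lemma const_fun_simps [simp]:
  "const_fun 0 = 0" "const_fun 1 = 1"
  by (simp_all add: eval_inject_iff eval_simps)

lemma const_fun_mult: "const_fun (a * b) = const_fun a * const_fun b"
  and const_fun_add: "const_fun (a + b) = const_fun a + const_fun b"
  by (simp_all add: eval_inject_iff eval_simps)

lemma const_fun_power: "const_fun (a ^ k) = const_fun a ^ k"
  by (induct k) (simp_all add: const_fun_mult)

lemma const_fun_of_nat: "const_fun (of_nat k) = of_nat k"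
  by (induct k) (simp_all add: const_fun_add)

lemma const_fun_sum: "const_fun (\<Sum>i\<in>I. f i) = (\<Sum>i\<in>I. const_fun (f i))"
  by (simp add: eval_inject_iff eval_simps eval_sum)

lemma const_fun_eq_0_iff [simp]: "const_fun c = 0 \<longleftrightarrow> c = 0"
  by (auto simp: eval_inject_iff eval_simps)

lemma act_const_fun [simp]: "act w (const_fun c) = const_fun c"
  by (simp add: eval_inject_iff eval_simps act.rep_eq)

lemma act_0 [simp]: "act w 0 = 0"
  by (simp add: eval_inject_iff eval_simps act.rep_eq)

lemma act_diff: "act w (f - g) = act w f - act w g"
  by (simp add: eval_inject_iff eval_simps act.rep_eq)

lemma act_sum: "act w (\<Sum>i\<in>I. f i) = (\<Sum>i\<in>I. act w (f i))"
  by (simp add: eval_inject_iff eval_sum act.rep_eq)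

lemma act_power: "act w (f ^ k) = act w f ^ k"
  by (simp add: eval_inject_iff eval_power act.rep_eq)

interpretation GL: group GL by (rule group_GL)

lemma GL_mult_vec: "(A \<otimes>\<^bsub>GL\<^esub> B) *v v = A *v (B *v v)"
  and GL_one_vec [simp]: "\<one>\<^bsub>GL\<^esub> *v v = v"
  by (simp_all add: GL_def matrix_vector_mul_assoc)

section \<open>Linear forms\<close>

definition linear_form :: "('a::field, 'n::finite) polyfun \<Rightarrow> bool" where
  "linear_form l \<longleftrightarrow> Vector_Spaces.linear (*s) (*) (eval l) \<and> l \<noteq> 0"

lemma linear_form_simps:
  assumes "linear_form l"
  shows "eval l (u + v) = eval l u + eval l v"
    and "eval l (c *s v) = c * eval l v"
    and "eval l (u - v) = eval l u - eval l v"
    and "eval l 0 = 0"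
proof -
  interpret Vector_Spaces.linear "(*s)" "(*)" "eval l" using assms by (simp add: linear_form_def)
  show "eval l (u + v) = eval l u + eval l v" by (rule add)
  show "eval l (c *s v) = c * eval l v" by (rule scale)
  show "eval l (u - v) = eval l u - eval l v" by (rule diff)
  show "eval l 0 = 0" by (rule zero)
qed

lemma linear_formI:
  assumes "\<And>u v. eval l (u + v) = eval l u + eval l v" "\<And>c v. eval l (c *s v) = c * eval l v"
    "l \<noteq> 0"
  shows "linear_form l"
proof -
  have "Vector_Spaces.linear (*s) (*) (eval l)"
    by unfold_locales (simp_all add: assms algebra_simps)
  then show ?thesis using assms by (simp add: linear_form_def)
qed

lemma linear_form_normalized:
  assumes "linear_form l"
  obtains v where "eval l v = 1"
proof -
  from assms obtain u where "eval l u \<noteq> 0"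
    by (auto simp: linear_form_def eval_inject_iff eval_simps)
  then have "eval l (inverse (eval l u) *s u) = 1" by (simp add: linear_form_simps[OF assms])
  then show ?thesis by (rule that)
qed

text \<open>If \<open>h\<close> moves each point by a multiple of the fixed vector \<open>a\<close>, the multiple being the value of \<open>l\<close>, then
  it moves the values of a polynomial function by multiples of \<open>l\<close>. The class of functions with this
  property contains the coordinates and is closed under products by the Leibniz rule; the induction also carries the
  fact that \<open>F \<circ> h\<close> is a polynomial function, which that rule needs. Transvections and
  pseudo-reflections have this shape, and so does the projection onto \<open>l = 0\<close>.\<close>

lemma difference_along_form:
  fixes l :: "('a::field, 'n::finite) polyfun" and h :: "'a ^ 'n \<Rightarrow> 'a ^ 'n"
  assumes h: "\<And>v. h v = v + eval l v *s a"
  shows "\<exists>g. \<forall>v. eval f (h v) - eval f v = eval l v * eval g v"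
proof -
  have "\<exists>f' g. \<forall>v. F (h v) = eval f' v \<and> F (h v) - F v = eval l v * eval g v"
    if "F \<in> poly_funs" for F
    using that
  proof (induction rule: poly_funs.induct)
    case (const c)
    show ?case by (rule exI[of _ "const_fun c"], rule exI[of _ 0]) (simp add: eval_simps)
  next
    case (coord k)
    define X where "X = Polyfun (\<lambda>v::'a^'n. v $ k)"
    have X: "eval X v = v $ k" for v by (simp add: X_def Polyfun_inverse poly_funs.coord)
    show ?case
      by (rule exI[of _ "X + l * const_fun (a $ k)"], rule exI[of _ "const_fun (a $ k)"])
        (simp add: eval_simps X h)
  next
    case (add F G)
    then obtain f' f'' g' g'' where *:
      "\<And>v. F (h v) = eval f' v" "\<And>v. F (h v) - F v = eval l v * eval f'' v"
      "\<And>v. G (h v) = eval g' v" "\<And>v. G (h v) - G v = eval l v * eval g'' v" by metis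
    have "F (h v) + G (h v) - (F v + G v) = (F (h v) - F v) + (G (h v) - G v)" for v by simp
    then have "F (h v) + G (h v) - (F v + G v) = eval l v * eval (f'' + g'') v" for v
      unfolding *(2,4) by (simp add: eval_simps distrib_left)
    moreover have "F (h v) + G (h v) = eval (f' + g') v" for v by (simp add: * eval_simps)
    ultimately show ?case by metis
  next
    case (mult F G)
    then obtain f' f'' g' g'' where *:
      "\<And>v. F (h v) = eval f' v" "\<And>v. F (h v) - F v = eval l v * eval f'' v"
      "\<And>v. G (h v) = eval g' v" "\<And>v. G (h v) - G v = eval l v * eval g'' v" by metis
    define G' where "G' = Polyfun G"
    have G': "eval G' v = G v" for v using mult.hyps by (simp add: G'_def Polyfun_inverse)
    have "F (h v) * G (h v) - F v * G v = (F (h v) - F v) * G v + F (h v) * (G (h v) - G v)" for v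
      by (simp add: algebra_simps)
    then have "F (h v) * G (h v) - F v * G v = eval l v * eval (f'' * G' + f' * g'') v" for v
      unfolding *(2,4) by (simp add: * G' eval_simps algebra_simps)
    moreover have "F (h v) * G (h v) = eval (f' * g') v" for v by (simp add: * eval_simps)
    ultimately show ?case by metis
  qed
  from this[OF eval] show ?thesis by metis
qed

text \<open>Compare \<open>f\<close> with its composition with the projection \<open>v \<mapsto> v - l(v) a\<close> onto the hyperplane \<open>l = 0\<close>,
  where \<open>l(a) = 1\<close>: the difference is a multiple of \<open>l\<close>, and the composition is zero.\<close>

lemma linear_form_dvd:
  assumes l: "linear_form l" and van: "\<And>v. eval l v = 0 \<Longrightarrow> eval f v = 0"
  shows "l dvd f"
proof -
  obtain a where a: "eval l a = 1" using linear_form_normalized[OF l] .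
  obtain g where g: "\<And>v. eval f (v + eval l v *s (- a)) - eval f v = eval l v * eval g v"
    using difference_along_form[of "\<lambda>v. v + eval l v *s (- a)" l "- a" f] by auto
  have "eval l (v + eval l v *s (- a)) = 0" for v
    using linear_form_simps(2)[OF l, of "-1" a] a
    by (simp add: linear_form_simps[OF l])
  then have "eval f (v + eval l v *s (- a)) = 0" for v using van by blast
  then have "- eval f v = eval l v * eval g v" for v using g[of v] by simp
  then have "f = l * (- g)" by (simp add: eval_inject_iff eval_simps) (metis minus_minus)
  then show ?thesis by simp
qed

text \<open>A linear form generates a prime ideal, so powers of \<open>l\<close> can be cancelled from a factor \<open>p\<close> outside that
  ideal. For primality, restrict to the line inside the hyperplane \<open>l = 0\<close> which joins \<open>u\<close> to a given
  point: there a product of two one-variable polynomials vanishes, and the first of them is not zero.\<close>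

lemma linear_form_power_dvd_cancel:
  fixes l p f :: "('a::alg_closed_field, 'n::finite) polyfun"
  assumes l: "linear_form l" and u: "eval l u = 0" "eval p u \<noteq> 0"
  shows "l ^ k dvd p * f \<Longrightarrow> l ^ k dvd f"
proof (induction k arbitrary: f)
  case (Suc k)
  have "eval f v = 0" if v: "eval l v = 0" for v
  proof -
    obtain P where P: "\<And>t. eval p (u + t *s (v - u)) = poly P t"
      using poly_funs_on_line[OF eval] by blast
    obtain Q where Q: "\<And>t. eval f (u + t *s (v - u)) = poly Q t"
      using poly_funs_on_line[OF eval] by blast
    have "poly (P * Q) t = 0" for t
    proof -
      have "eval l (u + t *s (v - u)) = 0" using u v by (simp add: linear_form_simps[OF l])
      moreover obtain g where "p * f = l * g" using Suc.prems by (auto simp: dvd_def mult.assoc)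
      ultimately have "eval (p * f) (u + t *s (v - u)) = 0" by (simp add: eval_simps)
      then show ?thesis by (simp add: eval_simps P Q)
    qed
    then have "P * Q = 0" by (rule poly_eq_0_of_values)
    moreover have "poly P 0 \<noteq> 0" using P[of 0] u by simp
    ultimately have "Q = 0" by auto
    then show ?thesis using Q[of 1] by simp
  qed
  then obtain g where g: "f = l * g" using linear_form_dvd[OF l] by blast
  have "l * l ^ k dvd l * (p * g)" using Suc.prems g by (simp add: mult_ac)
  then have "l ^ k dvd p * g" using l by (simp add: linear_form_def)
  then have "l ^ k dvd g" by (rule Suc.IH)
  then show ?case using g l by (simp add: linear_form_def)
qed simp

lemma linear_forms_proportional:
  assumes l: "linear_form l" and m: "linear_form m"
    and ker: "\<And>v. eval m v = 0 \<Longrightarrow> eval l v = 0"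
  obtains c where "c \<noteq> 0" "l = const_fun c * m"
proof -
  obtain a where a: "eval m a = 1" using linear_form_normalized[OF m] .
  have "eval m (v - eval m v *s a) = 0" for v using a by (simp add: linear_form_simps[OF m])
  then have "eval l (v - eval m v *s a) = 0" for v using ker by blast
  then have "eval l v - eval m v * eval l a = 0" for v
    by (simp only: linear_form_simps(2,3)[OF l])
  then have "eval l v = eval l a * eval m v" for v by (metis eq_iff_diff_eq_0 mult.commute)
  then have e: "l = const_fun (eval l a) * m"
    unfolding eval_inject_iff eval_simps by blast
  moreover have "eval l a \<noteq> 0" using e l by (auto simp: linear_form_def)
  ultimately show ?thesis using that by blast
qed

lemma linear_form_act:
  assumes "linear_form l" "w \<in> carrier GL"
  shows "linear_form (act w l)"
proof (rule linear_formI)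
  show "act w l \<noteq> 0"
  proof
    assume "act w l = 0"
    then have "act (inv\<^bsub>GL\<^esub> w) (act w l) = 0" by simp
    then have "act (inv\<^bsub>GL\<^esub> w \<otimes>\<^bsub>GL\<^esub> w) l = 0" using assms(2) by (simp only: act_act GL.inv_closed)
    then have "l = 0" using assms(2) by simp
    then show False using assms by (simp add: linear_form_def)
  qed
qed (simp_all add: act.rep_eq linear_form_simps[OF assms(1)] matrix_vector_right_distrib vector_scalar_commute)

section \<open>Pointwise stabilizers of hyperplanes\<close>

locale finite_linear_group =
  fixes W :: "('a::alg_closed_field ^ 'n::finite ^ 'n) set"
  assumes subgroup_W: "subgroup W GL"
    and finite_W: "finite W"
    and card_W: "(of_nat (card W) :: 'a) \<noteq> 0"
begin

lemma in_GL [simp]: "w \<in> W \<Longrightarrow> w \<in> carrier GL"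
  using subgroup.subset[OF subgroup_W] by blast

lemma mult_in_W [simp]: "u \<in> W \<Longrightarrow> w \<in> W \<Longrightarrow> u \<otimes>\<^bsub>GL\<^esub> w \<in> W"
  by (rule subgroup.m_closed[OF subgroup_W])

lemma one_in_W [simp]: "\<one>\<^bsub>GL\<^esub> \<in> W"
  by (rule subgroup.one_closed[OF subgroup_W])

lemma inv_in_W [simp]: "w \<in> W \<Longrightarrow> inv\<^bsub>GL\<^esub> w \<in> W"
  by (rule subgroup.m_inv_closed[OF subgroup_W])

lemma pow_in_W [simp]: "w \<in> W \<Longrightarrow> w [^]\<^bsub>GL\<^esub> (k::nat) \<in> W"
  by (induct k) simp_all

lemma pow_card_W:
  assumes "w \<in> W"
  shows "w [^]\<^bsub>GL\<^esub> card W = \<one>\<^bsub>GL\<^esub>"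
proof -
  have "group (GL\<lparr>carrier := W\<rparr>)" using subgroup_W by (rule GL.subgroup_imp_group)
  from group.pow_order_eq_1[OF this, of w] assms
  show ?thesis by (simp add: Coset.order_def GL.nat_pow_consistent[symmetric])
qed

text \<open>For a linear form \<open>l\<close> this consists of the identity and the pseudo-reflections along the hyperplane
  \<open>l = 0\<close>.\<close>

definition fixing_subgroup :: "('a, 'n) polyfun \<Rightarrow> ('a ^ 'n ^ 'n) set" where
  "fixing_subgroup l = {w \<in> W. \<forall>v. eval l v = 0 \<longrightarrow> w *v v = v}"

lemma fixing_subgroup_in_W: "w \<in> fixing_subgroup l \<Longrightarrow> w \<in> W"
  by (simp add: fixing_subgroup_def)

lemma inv_mult_vec: "w \<in> W \<Longrightarrow> inv\<^bsub>GL\<^esub> w *v (w *v v) = v"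
  by (simp flip: GL_mult_vec)

lemma fixing_subgroup_one [simp]: "\<one>\<^bsub>GL\<^esub> \<in> fixing_subgroup l"
  by (simp add: fixing_subgroup_def)

lemma fixing_subgroup_mult:
  "u \<in> fixing_subgroup l \<Longrightarrow> w \<in> fixing_subgroup l \<Longrightarrow> u \<otimes>\<^bsub>GL\<^esub> w \<in> fixing_subgroup l"
  by (simp add: fixing_subgroup_def GL_mult_vec)

lemma fixing_subgroup_inv:
  "w \<in> fixing_subgroup l \<Longrightarrow> inv\<^bsub>GL\<^esub> w \<in> fixing_subgroup l"
  unfolding fixing_subgroup_def using inv_mult_vec by (auto, metis)

lemma fixing_subgroup_pow:
  "w \<in> fixing_subgroup l \<Longrightarrow> w [^]\<^bsub>GL\<^esub> (k::nat) \<in> fixing_subgroup l"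
  by (induct k) (simp_all add: fixing_subgroup_mult)

lemma fixing_subgroup_conj:
  assumes "w \<in> fixing_subgroup l" "x \<in> W"
  shows "inv\<^bsub>GL\<^esub> x \<otimes>\<^bsub>GL\<^esub> w \<otimes>\<^bsub>GL\<^esub> x \<in> fixing_subgroup (act (inv\<^bsub>GL\<^esub> x) l)"
  using assms by (simp add: fixing_subgroup_def act.rep_eq GL_mult_vec inv_mult_vec)

lemma fixing_subgroup_displacement:
  assumes l: "linear_form l" and w: "w \<in> fixing_subgroup l"
  obtains a where "\<And>v. w *v v = v + eval l v *s a"
proof -
  obtain b where b: "eval l b = 1" using linear_form_normalized[OF l] .
  have "w *v v = v + eval l v *s (w *v b - b)" for v
  proof -
    have "eval l (v - eval l v *s b) = 0" using b by (simp add: linear_form_simps[OF l])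
    then have "w *v (v - eval l v *s b) = v - eval l v *s b"
      using w by (simp add: fixing_subgroup_def)
    then have "w *v v - eval l v *s (w *v b) = v - eval l v *s b"
      by (simp add: matrix_vector_mult_diff_distrib vector_scalar_commute)
    then show ?thesis by (simp add: vector_ssub_ldistrib algebra_simps)
  qed
  then show ?thesis by (rule that)
qed

lemma fixing_subgroup_act_dvd:
  assumes l: "linear_form l" and w: "w \<in> fixing_subgroup l"
  shows "l dvd act w f - f"
proof -
  obtain a where a: "\<And>v. inv\<^bsub>GL\<^esub> w *v v = v + eval l v *s a"
    using fixing_subgroup_displacement[OF l fixing_subgroup_inv[OF w]] by metis
  obtain g where "\<forall>v. eval f (inv\<^bsub>GL\<^esub> w *v v) - eval f v = eval l v * eval g v"
    using difference_along_form[OF a] by metis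
  then have "act w f - f = l * g" by (simp add: eval_inject_iff eval_simps act.rep_eq)
  then show ?thesis by simp
qed

lemma fixing_subgroup_scales:
  assumes l: "linear_form l" and w: "w \<in> fixing_subgroup l"
  obtains c where "act w l = const_fun c * l"
proof -
  obtain a where a: "\<And>v. inv\<^bsub>GL\<^esub> w *v v = v + eval l v *s a"
    using fixing_subgroup_displacement[OF l fixing_subgroup_inv[OF w]] by metis
  have "act w l = const_fun (1 + eval l a) * l"
    by (simp add: eval_inject_iff eval_simps act.rep_eq a linear_form_simps[OF l] algebra_simps)
  then show ?thesis by (rule that)
qed

lemma act_pow_eigen:
  assumes "w \<in> W" "act w f = const_fun c * f"
  shows "act (w [^]\<^bsub>GL\<^esub> (k::nat)) f = const_fun (c ^ k) * f"
  by (induct k) (use assms in \<open>simp_all add: act_act act_mult const_fun_mult mult_ac\<close>)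

text \<open>An element that fixes the hyperplane pointwise and the form \<open>l\<close> itself is a transvection
  \<open>v \<mapsto> v + l(v) a\<close> with \<open>l(a) = 0\<close>; its \<open>k\<close>-th power is \<open>v \<mapsto> v + k l(v) a\<close>. Since \<open>|W|\<close> is invertible in
  the field and annihilates it, \<open>a = 0\<close>.\<close>

lemma fixing_subgroup_faithful:
  assumes l: "linear_form l" and w: "w \<in> fixing_subgroup l" and eq: "act w l = l"
  shows "w = \<one>\<^bsub>GL\<^esub>"
proof -
  let ?i = "inv\<^bsub>GL\<^esub> w"
  have iW: "?i \<in> W" using fixing_subgroup_in_W[OF w] by simp
  obtain a where a: "\<And>v. ?i *v v = v + eval l v *s a"
    using fixing_subgroup_displacement[OF l fixing_subgroup_inv[OF w]] by metis
  obtain b where b: "eval l b = 1" using linear_form_normalized[OF l] .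
  have "eval l (?i *v b) = eval l b" using arg_cong[OF eq, of "\<lambda>f. eval f b"] by (simp add: act.rep_eq)
  then have la: "eval l a = 0" using b by (simp add: a linear_form_simps[OF l])
  have "?i [^]\<^bsub>GL\<^esub> k *v v = v + (of_nat k * eval l v) *s a" for k :: nat and v
  proof (induct k arbitrary: v)
    case (Suc k)
    have "?i [^]\<^bsub>GL\<^esub> Suc k *v v = ?i [^]\<^bsub>GL\<^esub> k *v (v + eval l v *s a)"
      by (simp add: GL_mult_vec a)
    also have "\<dots> = v + (of_nat (Suc k) * eval l v) *s a"
      by (simp add: Suc linear_form_simps[OF l] la algebra_simps vec.scale_left_distrib)
    finally show ?case .
  qed simp
  from this[of "card W" b] have "of_nat (card W) *s a = 0"
    using iW b by (simp add: pow_card_W)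
  then have "a = 0" using card_W by simp
  then have "?i *v v = v" for v by (simp add: a)
  then have "w *v v = v" for v using inv_mult_vec[OF iW] fixing_subgroup_in_W[OF w] by (metis GL.inv_inv in_GL)
  then show ?thesis by (metis GL_one_vec matrix_eq)
qed

text \<open>The scalar by which an element multiplies \<open>l\<close> is a character of the stabilizer, injective by
  \<open>fixing_subgroup_faithful\<close>. Its image is a finite multiplicative subset of the field, hence cyclic.\<close>

lemma fixing_subgroup_cyclic:
  assumes l: "linear_form l"
  obtains r z where "r \<in> fixing_subgroup l" "act r l = const_fun z * l"
    "fixing_subgroup l = (\<lambda>j::nat. r [^]\<^bsub>GL\<^esub> j) ` {..<card (fixing_subgroup l)}"
    "\<And>k. z ^ k = 1 \<longleftrightarrow> card (fixing_subgroup l) dvd k"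
    "(of_nat (card (fixing_subgroup l)) :: 'a) \<noteq> 0"
    "GL.ord r = card (fixing_subgroup l)"
proof -
  let ?U = "fixing_subgroup l"
  have l0: "l \<noteq> 0" using l by (simp add: linear_form_def)
  have finU: "finite ?U" using finite_W by (rule finite_subset[rotated]) (auto simp: fixing_subgroup_def)
  define chi where "chi w = (SOME c. act w l = const_fun c * l)" for w
  have chi: "act w l = const_fun (chi w) * l" if "w \<in> ?U" for w
    unfolding chi_def by (rule someI_ex) (use fixing_subgroup_scales[OF l that] in blast)
  have uniq: "c = d" if "const_fun c * l = const_fun d * l" for c d
  proof -
    have "const_fun c - const_fun d = (0 :: ('a, 'n) polyfun)" using that l0 by simp
    then have "const_fun (c - d) = (0 :: ('a, 'n) polyfun)" by (simp add: eval_inject_iff eval_simps)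
    then show ?thesis by simp
  qed
  have chi_mult: "chi (u \<otimes>\<^bsub>GL\<^esub> w) = chi u * chi w" if "u \<in> ?U" "w \<in> ?U" for u w
  proof (rule uniq)
    have "const_fun (chi (u \<otimes>\<^bsub>GL\<^esub> w)) * l = act (u \<otimes>\<^bsub>GL\<^esub> w) l"
      using chi fixing_subgroup_mult that by metis
    also have "\<dots> = const_fun (chi u * chi w) * l"
      using that by (simp add: act_act fixing_subgroup_in_W chi act_mult const_fun_mult mult_ac)
    finally show "const_fun (chi (u \<otimes>\<^bsub>GL\<^esub> w)) * l = const_fun (chi u * chi w) * l" .
  qed
  have chi_one: "chi \<one>\<^bsub>GL\<^esub> = 1" by (rule uniq) (simp flip: chi)
  have chi_eq_1: "w = \<one>\<^bsub>GL\<^esub>" if "w \<in> ?U" "chi w = 1" for w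
    using fixing_subgroup_faithful[OF l that(1)] chi[OF that(1)] that(2) by simp
  have chi_inv: "chi (inv\<^bsub>GL\<^esub> w) * chi w = 1" if "w \<in> ?U" for w
    using chi_mult[OF fixing_subgroup_inv[OF that] that] that
    by (simp add: chi_one fixing_subgroup_in_W)
  have inj: "inj_on chi ?U"
  proof (rule inj_onI)
    fix u w assume uw: "u \<in> ?U" "w \<in> ?U" "chi u = chi w"
    then have "chi (inv\<^bsub>GL\<^esub> u \<otimes>\<^bsub>GL\<^esub> w) = 1"
      using chi_inv[OF uw(1)] by (simp add: chi_mult fixing_subgroup_inv)
    then have "inv\<^bsub>GL\<^esub> u \<otimes>\<^bsub>GL\<^esub> w = \<one>\<^bsub>GL\<^esub>"
      using uw by (intro chi_eq_1 fixing_subgroup_mult fixing_subgroup_inv)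
    then have "u \<otimes>\<^bsub>GL\<^esub> (inv\<^bsub>GL\<^esub> u \<otimes>\<^bsub>GL\<^esub> w) = u" using uw fixing_subgroup_in_W by simp
    then show "u = w" using uw by (simp add: fixing_subgroup_in_W GL.m_assoc[symmetric])
  qed
  let ?e = "card ?U"
  have "\<exists>z\<in>chi ` ?U. \<forall>k. z ^ k = 1 \<longleftrightarrow> card (chi ` ?U) dvd k"
  proof (rule exact_order_in_finite_multiplicative_set)
    show "finite (chi ` ?U)" using finU by simp
    show "1 \<in> chi ` ?U" by (rule image_eqI[of _ _ "\<one>\<^bsub>GL\<^esub>"]) (simp_all add: chi_one)
    show "0 \<notin> chi ` ?U"
    proof
      assume "0 \<in> chi ` ?U"
      then obtain w where "w \<in> ?U" "chi w = 0" by auto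
      then show False using chi_inv[of w] by simp
    qed
    fix x y assume "x \<in> chi ` ?U" "y \<in> chi ` ?U"
    then show "x * y \<in> chi ` ?U" by (auto simp flip: chi_mult intro: fixing_subgroup_mult)
  qed
  then obtain r where r: "r \<in> ?U" and ord: "\<And>k. chi r ^ k = 1 \<longleftrightarrow> ?e dvd k"
    by (auto simp: card_image[OF inj])
  have rW: "r \<in> W" using fixing_subgroup_in_W[OF r] .
  have chi_pow: "chi (r [^]\<^bsub>GL\<^esub> (k::nat)) = chi r ^ k" for k
    by (induct k) (simp_all add: chi_one chi_mult r fixing_subgroup_pow mult_ac)
  have pow1: "r [^]\<^bsub>GL\<^esub> (k::nat) = \<one>\<^bsub>GL\<^esub> \<longleftrightarrow> ?e dvd k" for k
    using chi_eq_1[OF fixing_subgroup_pow[OF r, of k]] chi_one chi_pow[of k] ord[of k] by metis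
  have ordr: "GL.ord r = ?e" using rW pow1 by (simp add: GL.ord_unique)
  have e0: "?e > 0" using finU card_gt_0_iff fixing_subgroup_one by blast
  have "inj_on (\<lambda>j::nat. r [^]\<^bsub>GL\<^esub> j) {..<?e}"
  proof -
    have "inj_on (\<lambda>j::nat. r [^]\<^bsub>GL\<^esub> j) {0..GL.ord r - 1}" by (rule GL.ord_inj) (use rW in simp)
    moreover have "{0..GL.ord r - 1} = {..<?e}" using ordr e0 by auto
    ultimately show ?thesis by simp
  qed
  then have gen: "?U = (\<lambda>j::nat. r [^]\<^bsub>GL\<^esub> j) ` {..<?e}"
    by (intro card_subset_eq[symmetric] finU) (auto simp: card_image fixing_subgroup_pow r)
  have "?e dvd card W" using pow_card_W[OF rW] pow1 by blast
  then have "(of_nat ?e :: 'a) \<noteq> 0" using card_W by (auto simp: dvd_def)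
  with that[OF r chi[OF r] gen ord _ ordr] show ?thesis by blast
qed

text \<open>The fixed space of \<open>s\<close> is contained in \<open>l = 0\<close>. Equality holds because adding one more vector to a hyperplane
  spans the whole space, on which \<open>l\<close> would then vanish.\<close>

lemma coroot_fixing_subgroup:
  assumes s: "s \<in> pseudo_reflections W" and co: "is_coroot s l"
  shows "linear_form l" and "s \<in> fixing_subgroup l" and "fixed_space s = {v. eval l v = 0}"
proof -
  show l: "linear_form l" using co by (simp add: is_coroot_def linear_form_def)
  have sub: "vec.subspace (fixed_space s)" and dim: "vec.dim (fixed_space s) + 1 = CARD('n)"
    using s by (auto simp: pseudo_reflections_def is_hyperplane_def)
  have van: "eval l v = 0" if "v \<in> fixed_space s" for v
    using co that by (simp add: is_coroot_def)
  have fixed: "v \<in> fixed_space s" if v: "eval l v = 0" for v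
  proof (rule ccontr)
    assume "v \<notin> fixed_space s"
    then have nspan: "v \<notin> vec.span (fixed_space s)" using sub by (simp add: vec.span_eq_iff[THEN iffD2])
    then have "vec.dim (insert v (fixed_space s)) = CARD('n)"
      using dim by (simp add: vec.dim_insert)
    then have "vec.dim (insert v (fixed_space s)) = vec.dim (UNIV :: ('a ^ 'n) set)"
      by (simp add: vec.dim_UNIV card_cart_basis)
    then have full: "vec.span (insert v (fixed_space s)) = vec.span UNIV"
      by (intro vec.dim_eq_span) auto
    obtain b where b: "eval l b = 1" using linear_form_normalized[OF l] .
    have "b \<in> vec.span (insert v (fixed_space s))" using full by simp
    moreover have "vec.span (insert v (fixed_space s)) \<subseteq> {v. eval l v = 0}"
    proof (rule vec.span_minimal)
      show "insert v (fixed_space s) \<subseteq> {v. eval l v = 0}" using van v by auto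
      show "vec.subspace {v. eval l v = 0}"
        by (rule vec.subspaceI) (simp_all add: linear_form_simps[OF l])
    qed
    ultimately show False using b by auto
  qed
  show "fixed_space s = {v. eval l v = 0}" using van fixed by blast
  then show "s \<in> fixing_subgroup l"
    using s by (auto simp: fixing_subgroup_def pseudo_reflections_def fixed_space_def)
qed

text \<open>The displacement \<open>w v - v = l(v) a\<close> is non-zero outside the kernel of \<open>l\<close>, so the fixed space of \<open>w\<close> is
  exactly that kernel.\<close>

lemma fixing_subgroup_reflection:
  assumes l: "linear_form l" and w: "w \<in> fixing_subgroup l" "w \<noteq> \<one>\<^bsub>GL\<^esub>"
  shows "w \<in> pseudo_reflections W" and "is_coroot w l"
proof -
  obtain a where a: "\<And>v. w *v v = v + eval l v *s a"
    using fixing_subgroup_displacement[OF l w(1)] by metis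
  have "a \<noteq> 0"
  proof
    assume "a = 0"
    then have "w *v v = \<one>\<^bsub>GL\<^esub> *v v" for v by (simp add: a)
    then show False using w(2) by (metis matrix_eq)
  qed
  then have ker: "fixed_space w = {v. eval l v = 0}" by (auto simp: fixed_space_def a)
  obtain b where b: "eval l b = 1" using linear_form_normalized[OF l] .
  have sub: "vec.subspace (fixed_space w)"
    unfolding ker by (rule vec.subspaceI) (simp_all add: linear_form_simps[OF l])
  have "b \<notin> vec.span (fixed_space w)"
    using sub b by (simp add: vec.span_eq_iff[THEN iffD2]) (simp add: ker)
  then have "vec.dim (insert b (fixed_space w)) = vec.dim (fixed_space w) + 1"
    by (simp add: vec.dim_insert)
  moreover have "vec.span (insert b (fixed_space w)) = UNIV"
  proof -
    have "v \<in> vec.span (insert b (fixed_space w))" for v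
    proof -
      have "v - eval l v *s b \<in> fixed_space w" using b by (simp add: ker linear_form_simps[OF l])
      then have "(v - eval l v *s b) + eval l v *s b \<in> vec.span (insert b (fixed_space w))"
        by (intro vec.span_add vec.span_scale vec.span_base) auto
      then show ?thesis by simp
    qed
    then show ?thesis by blast
  qed
  then have "vec.dim (insert b (fixed_space w)) = CARD('n)"
    by (metis vec.dim_span vec.dim_UNIV card_cart_basis)
  ultimately show "w \<in> pseudo_reflections W"
    using w sub by (simp add: pseudo_reflections_def is_hyperplane_def fixing_subgroup_in_W)
  show "is_coroot w l" using l ker by (simp add: is_coroot_def linear_form_def)
qed

end

section \<open>Operators on the left tensor factor\<close>

text \<open>The operator \<open>\<phi> \<otimes> 1\<close> on formal linear combinations of pairs. It descends to the tensor product
  only for suitable \<open>\<phi>\<close>, see \<open>map_left_tensor_kernel\<close>.\<close>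

definition map_left ::
  "('r \<Rightarrow> 'r) \<Rightarrow> ('r \<times> 'r \<Rightarrow>\<^sub>0 int) \<Rightarrow> ('r \<times> 'r \<Rightarrow>\<^sub>0 int)" where
  "map_left \<phi> = frag_extend (\<lambda>(f, g). frag_of (\<phi> f, g))"

lemma map_left_frag_of [simp]: "map_left \<phi> (frag_of (f, g)) = frag_of (\<phi> f, g)"
  by (simp add: map_left_def)

lemma map_left_0 [simp]: "map_left \<phi> 0 = 0"
  by (simp add: map_left_def)

lemma map_left_add: "map_left \<phi> (c + d) = map_left \<phi> c + map_left \<phi> d"
  by (simp add: map_left_def frag_extend_add)

lemma map_left_diff: "map_left \<phi> (c - d) = map_left \<phi> c - map_left \<phi> d"
  by (simp add: map_left_def frag_extend_diff)

lemma map_left_minus: "map_left \<phi> (- c) = - map_left \<phi> c"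
  by (simp add: map_left_def frag_extend_minus)

lemma frag_pair_induct [case_names zero one diff]:
  assumes "P 0" "\<And>f g. P (frag_of (f, g))" "\<And>c d. P c \<Longrightarrow> P d \<Longrightarrow> P (c - d)"
  shows "P (c :: 'r \<times> 'r \<Rightarrow>\<^sub>0 int)"
  by (rule frag_induction[of c UNIV]) (use assms in auto)

lemma map_left_map_left: "map_left \<phi> (map_left \<psi> c) = map_left (\<lambda>f. \<phi> (\<psi> f)) c"
  by (induct c rule: frag_pair_induct) (simp_all add: map_left_diff)

lemma localization_lift_map_left:
  assumes x: "x \<in> U" "x' \<in> U"
    and h: "h 0 = 0" "\<And>a b. h (a - b) = h a - h b"
    and \<phi>: "\<And>f g. \<phi> f * act x g = h (f * act x' g)"
  shows "localization_lift U (map_left \<phi> c) x = h (localization_lift U c x')"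
  by (induct c rule: frag_pair_induct)
    (simp_all add: map_left_diff localization_lift_0 localization_lift_diff localization_lift_frag_of x h \<phi>)

lemma localization_lift_scale:
  "x \<in> U \<Longrightarrow> localization_lift U (map_left ((*) p) c) x = p * localization_lift U c x"
  by (rule localization_lift_map_left) (simp_all add: algebra_simps)

lemma localization_lift_map_left_diff:
  assumes x: "x \<in> U"
  shows "localization_lift U (map_left (\<lambda>f. \<phi> f - \<psi> f) c) x =
    localization_lift U (map_left \<phi> c) x - localization_lift U (map_left \<psi> c) x"
  by (induct c rule: frag_pair_induct)
    (simp_all add: map_left_diff localization_lift_0 localization_lift_diff localization_lift_frag_of x
      algebra_simps)

lemma localization_lift_sum:
  "x \<in> U \<Longrightarrow> localization_lift U (\<Sum>i\<in>I. c i) x = (\<Sum>i\<in>I. localization_lift U (c i) x)"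
  by (induct I rule: infinite_finite_induct) (simp_all add: localization_lift_0 localization_lift_add)

text \<open>Equivariance of the localization map: \<open>u \<otimes> 1\<close> corresponds to the action \<open>F \<mapsto> (x \<mapsto> u(F(u\<inverse> x)))\<close>.\<close>

lemma localization_lift_act:
  assumes "u \<in> carrier GL" "x \<in> carrier GL" "x \<in> U" "inv\<^bsub>GL\<^esub> u \<otimes>\<^bsub>GL\<^esub> x \<in> U"
  shows "localization_lift U (map_left (act u) c) x =
    act u (localization_lift U c (inv\<^bsub>GL\<^esub> u \<otimes>\<^bsub>GL\<^esub> x))"
proof (rule localization_lift_map_left)
  fix f g
  show "act u f * act x g = act u (f * act (inv\<^bsub>GL\<^esub> u \<otimes>\<^bsub>GL\<^esub> x) g)"
    using assms by (simp add: act_mult GL.m_assoc[symmetric] flip: act_act)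
qed (use assms in \<open>simp_all add: act_diff\<close>)

section \<open>Fourier analysis on the stabilizer of a hyperplane\<close>

text \<open>Translation invariance of a sum over the cyclic group of order \<open>m\<close>.\<close>

lemma sum_shift_cyclic:
  fixes t :: "nat \<Rightarrow> 'b::comm_monoid_add"
  assumes "t m = t 0"
  shows "(\<Sum>j<m. t (Suc j)) = (\<Sum>j<m. t j)"
proof (cases m)
  case (Suc k)
  have "(\<Sum>j<Suc k. t j) = t 0 + (\<Sum>j<k. t (Suc j))" by (rule sum.lessThan_Suc_shift)
  moreover have "(\<Sum>j<Suc k. t (Suc j)) = (\<Sum>j<k. t (Suc j)) + t (Suc k)" by simp
  ultimately show ?thesis using assms Suc by (simp add: add.commute)
qed simp

lemma sum_root_of_unity_powers:
  fixes q :: "'a::field"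
  assumes "q ^ e = 1"
  shows "(\<Sum>i<e. q ^ i) = (if q = 1 then of_nat e else 0)"
  using assms geometric_sum[of q e] by auto

context finite_linear_group
begin

text \<open>An eigenvector of \<open>w\<close> whose eigenvalue is not \<open>1\<close> vanishes on the hyperplane that \<open>w\<close> fixes, hence is a
  multiple of \<open>l\<close>. Dividing by \<open>l\<close> lowers the exponent of the eigenvalue by one, and this can be repeated
  \<open>i\<close> times.\<close>

lemma eigenvector_dvd:
  assumes l: "linear_form l" and w: "w \<in> fixing_subgroup l" and wl: "act w l = const_fun z * l"
    and z: "\<And>k. 0 < k \<Longrightarrow> k < m \<Longrightarrow> z ^ k \<noteq> 1"
  shows "act w E = const_fun (z ^ i) * E \<Longrightarrow> i < m \<Longrightarrow> l ^ i dvd E"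
proof (induction i arbitrary: E)
  case (Suc i)
  have "eval E v = 0" if v: "eval l v = 0" for v
  proof -
    have "inv\<^bsub>GL\<^esub> w *v v = v" using fixing_subgroup_inv[OF w] v by (simp add: fixing_subgroup_def)
    then have "eval E v = z ^ Suc i * eval E v"
      using arg_cong[OF Suc.prems(1), of "\<lambda>f. eval f v"] by (simp add: act.rep_eq eval_simps)
    moreover have "z ^ Suc i \<noteq> 1" using z Suc.prems by blast
    ultimately show ?thesis by (metis mult_cancel_right1)
  qed
  then obtain E' where E': "E = l * E'" using linear_form_dvd[OF l] by blast
  have "l \<noteq> 0" using l by (simp add: linear_form_def)
  have "act w l \<noteq> 0" using linear_form_act[OF l] fixing_subgroup_in_W[OF w] by (simp add: linear_form_def)
  then have "const_fun z \<noteq> (0 :: ('a, 'n) polyfun)" using wl by auto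
  have "const_fun z * l * act w E' = const_fun z * l * (const_fun (z ^ i) * E')"
    using Suc.prems(1) by (simp add: E' act_mult wl const_fun_mult mult_ac)
  then have "act w E' = const_fun (z ^ i) * E'"
    using \<open>l \<noteq> 0\<close> \<open>const_fun z \<noteq> 0\<close> by (simp only: mult_cancel_left no_zero_divisors) auto
  then have "l ^ i dvd E'" using Suc.IH Suc.prems(2) by simp
  then show ?case by (simp add: E')
qed simp

text \<open>The \<open>i\<close>-th Fourier coefficient of \<open>j \<mapsto> f w\<^sup>j(g)\<close> is \<open>f\<close> times an eigenvector of \<open>w\<close> with eigenvalue
  \<open>z\<^sup>i\<close>.\<close>

lemma tensor_transform_dvd:
  assumes l: "linear_form l" and w: "w \<in> fixing_subgroup l" and wl: "act w l = const_fun z * l"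
    and z: "\<And>k. 0 < k \<Longrightarrow> k < m \<Longrightarrow> z ^ k \<noteq> 1" and wm: "w [^]\<^bsub>GL\<^esub> m = \<one>\<^bsub>GL\<^esub>" "z ^ m = 1"
    and i: "i < m"
  shows "l ^ i dvd (\<Sum>j<m. const_fun (inverse z ^ (i * j)) *
    localization_lift (fixing_subgroup l) c (w [^]\<^bsub>GL\<^esub> j))"
proof (induct c rule: frag_pair_induct)
  case zero
  then show ?case by (simp add: localization_lift_0 fixing_subgroup_pow[OF w])
next
  case (diff c d)
  then show ?case
    by (simp add: localization_lift_diff fixing_subgroup_pow[OF w] right_diff_distrib sum_subtractf dvd_diff)
next
  case (one f g)
  define t where "t j = const_fun (inverse z ^ (i * j)) * act (w [^]\<^bsub>GL\<^esub> j) g" for j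
  define E where "E = (\<Sum>j<m. t j)"
  have wW: "w \<in> W" using fixing_subgroup_in_W[OF w] .
  have z0: "z \<noteq> 0" using wm i by (metis gr_implies_not0 power_0_left zero_neq_one)
  have wt: "act w (t j) = const_fun (z ^ i) * t (Suc j)" for j
  proof -
    have "w \<otimes>\<^bsub>GL\<^esub> w [^]\<^bsub>GL\<^esub> j = w [^]\<^bsub>GL\<^esub> Suc j" using wW by (metis GL.nat_pow_Suc2 in_GL)
    moreover have "z ^ i * inverse z ^ (i * Suc j) = inverse z ^ (i * j)"
      using z0 by (simp add: power_add power_inverse flip: power_mult_distrib)
    ultimately show ?thesis
      using wW by (simp add: t_def act_mult flip: act_act mult.assoc const_fun_mult del: GL.nat_pow_Suc)
  qed
  have "t m = t 0" using wm by (simp add: t_def power_inverse power_mult mult.commute[of i])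
  then have "(\<Sum>j<m. t (Suc j)) = E" unfolding E_def by (rule sum_shift_cyclic)
  then have "act w E = const_fun (z ^ i) * E"
    unfolding E_def act_sum by (simp add: wt flip: sum_distrib_left)
  then have "l ^ i dvd E" using eigenvector_dvd[OF l w wl z] i by blast
  moreover have "(\<Sum>j<m. const_fun (inverse z ^ (i * j)) *
    localization_lift (fixing_subgroup l) (frag_of (f, g)) (w [^]\<^bsub>GL\<^esub> j)) = f * E"
    by (simp add: E_def t_def localization_lift_frag_of fixing_subgroup_pow[OF w] sum_distrib_left mult_ac)
  ultimately show ?case by simp
qed

text \<open>Fourier inversion: if the \<open>i\<close>-th coefficient of \<open>G\<close> is \<open>l\<^sup>i h\<^sub>i\<close>, then \<open>G(r\<^sup>k)\<close> is the mean over \<open>i\<close> of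
  \<open>z\<^bsup>ki\<^esup> l\<^sup>i h\<^sub>i\<close>, and \<open>z\<^bsup>ki\<^esup> l\<^sup>i\<close> is \<open>r\<^sup>k(l\<^sup>i)\<close>. So the tensor \<open>\<Sum> h\<^sub>i \<otimes> l\<^sup>i\<close>, divided by \<open>e\<close>, represents \<open>G\<close>.\<close>

lemma tensor_of_transform_dvd:
  assumes l: "linear_form l" and r: "r \<in> fixing_subgroup l" and rl: "act r l = const_fun z * l"
    and gen: "fixing_subgroup l = (\<lambda>j::nat. r [^]\<^bsub>GL\<^esub> j) ` {..<e}"
    and z: "\<And>k. z ^ k = 1 \<longleftrightarrow> e dvd k" and e: "(of_nat e :: 'a) \<noteq> 0"
    and dvd: "\<And>i. i < e \<Longrightarrow> l ^ i dvd (\<Sum>j<e. const_fun (inverse z ^ (i * j)) * G (r [^]\<^bsub>GL\<^esub> j))"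
  shows "\<exists>c. \<forall>w\<in>fixing_subgroup l. G w = localization_lift (fixing_subgroup l) c w"
proof -
  have "\<forall>i. \<exists>h. i < e \<longrightarrow> (\<Sum>j<e. const_fun (inverse z ^ (i * j)) * G (r [^]\<^bsub>GL\<^esub> j)) = l ^ i * h"
    using dvd by (auto simp: dvd_def)
  then obtain h where h: "\<And>i. i < e \<Longrightarrow>
      (\<Sum>j<e. const_fun (inverse z ^ (i * j)) * G (r [^]\<^bsub>GL\<^esub> j)) = l ^ i * h i"
    by metis
  define c where "c = (\<Sum>i<e. frag_of (const_fun (inverse (of_nat e)) * h i, l ^ i))"
  have e0: "e > 0" using e by (intro Nat.gr0I) auto
  have ze: "z ^ e = 1" using z by simp
  then have z0: "z \<noteq> 0" using e0 by (metis gr_implies_not0 power_0_left zero_neq_one)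
  have rW: "r \<in> W" using fixing_subgroup_in_W[OF r] .
  have "G (r [^]\<^bsub>GL\<^esub> k) = localization_lift (fixing_subgroup l) c (r [^]\<^bsub>GL\<^esub> k)" if k: "k < e" for k
  proof -
    \<comment> \<open>Orthogonality of characters.\<close>
    have orth: "(\<Sum>i<e. z ^ (k * i) * inverse z ^ (i * j)) = (if j = k then of_nat e else 0)"
      if j: "j < e" for j
    proof -
      define q where "q = z ^ k * inverse z ^ j"
      have "q = 1 \<longleftrightarrow> j = k"
      proof
        assume "q = 1"
        then have eq: "z ^ k = z ^ j" using z0 by (simp add: q_def power_inverse field_simps)
        show "j = k"
        proof (rule ccontr)
          assume "j \<noteq> k"
          then consider "j < k" | "k < j" by linarith
          then show False
          proof cases
            case 1
            then have "z ^ (k - j) = 1" using eq z0 by (simp add: power_diff)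
            then show False using z 1 k by (metis dvd_imp_le less_imp_diff_less not_le zero_less_diff)
          next
            case 2
            then have "z ^ (j - k) = 1" using eq z0 by (simp add: power_diff)
            then show False using z 2 j by (metis dvd_imp_le less_imp_diff_less not_le zero_less_diff)
          qed
        qed
      qed (use z0 in \<open>simp add: q_def power_inverse\<close>)
      moreover have "q ^ e = 1"
        by (simp add: q_def power_mult_distrib power_inverse flip: power_mult)
          (simp add: mult.commute[of _ e] power_mult ze)
      moreover have "z ^ (k * i) * inverse z ^ (i * j) = q ^ i" for i
        by (simp add: q_def power_mult_distrib mult.commute[of i] flip: power_mult)
      ultimately show ?thesis using sum_root_of_unity_powers[of q e] by simp
    qed
    have act_pow: "act (r [^]\<^bsub>GL\<^esub> k) (l ^ i) = const_fun (z ^ (k * i)) * l ^ i" for i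
      by (simp add: act_power act_pow_eigen[OF rW rl] power_mult_distrib power_mult flip: const_fun_power)
    have "localization_lift (fixing_subgroup l) c (r [^]\<^bsub>GL\<^esub> k) =
      (\<Sum>i<e. const_fun (inverse (of_nat e)) * h i * act (r [^]\<^bsub>GL\<^esub> k) (l ^ i))"
      by (simp add: c_def localization_lift_sum localization_lift_frag_of fixing_subgroup_pow[OF r])
    also have "\<dots> = const_fun (inverse (of_nat e)) *
        (\<Sum>i<e. const_fun (z ^ (k * i)) * (l ^ i * h i))"
      by (simp add: act_pow sum_distrib_left mult_ac)
    also have "(\<Sum>i<e. const_fun (z ^ (k * i)) * (l ^ i * h i)) =
        (\<Sum>i<e. \<Sum>j<e. const_fun (z ^ (k * i) * inverse z ^ (i * j)) * G (r [^]\<^bsub>GL\<^esub> j))"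
      by (intro sum.cong refl) (simp only: lessThan_iff h[symmetric], simp add: sum_distrib_left const_fun_mult mult_ac)
    also have "\<dots> = (\<Sum>j<e. const_fun (\<Sum>i<e. z ^ (k * i) * inverse z ^ (i * j)) * G (r [^]\<^bsub>GL\<^esub> j))"
      by (subst sum.swap) (simp add: const_fun_sum sum_distrib_right)
    also have "\<dots> = (\<Sum>j<e. if j = k then const_fun (of_nat e) * G (r [^]\<^bsub>GL\<^esub> j) else 0)"
      by (intro sum.cong refl) (simp add: orth)
    also have "\<dots> = const_fun (of_nat e) * G (r [^]\<^bsub>GL\<^esub> k)" using k by simp
    finally have "localization_lift (fixing_subgroup l) c (r [^]\<^bsub>GL\<^esub> k) =
        (const_fun (inverse (of_nat e)) * const_fun (of_nat e)) * G (r [^]\<^bsub>GL\<^esub> k)"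
      by (simp only: mult.assoc)
    moreover have "const_fun (inverse (of_nat e)) * const_fun (of_nat e) = (1 :: ('a, 'n) polyfun)"
      using e by (simp flip: const_fun_mult)
    ultimately show ?thesis by simp
  qed
  then have "G w = localization_lift (fixing_subgroup l) c w" if "w \<in> fixing_subgroup l" for w
    using that gen by auto
  then show ?thesis by blast
qed

text \<open>The maps on the stabilizer that come from tensors are those with Fourier coefficients divisible by
  powers of \<open>l\<close>; that description allows a factor \<open>p\<close> coprime to \<open>l\<close> to be cancelled.\<close>

lemma tensor_saturated:
  assumes l: "linear_form l" and p: "eval l u = 0" "eval p u \<noteq> 0"
    and c: "\<And>w. w \<in> fixing_subgroup l \<Longrightarrow> p * G w = localization_lift (fixing_subgroup l) c w"
  shows "\<exists>d. \<forall>w\<in>fixing_subgroup l. G w = localization_lift (fixing_subgroup l) d w"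
proof -
  let ?e = "card (fixing_subgroup l)"
  obtain r z where r: "r \<in> fixing_subgroup l" "act r l = const_fun z * l"
    "fixing_subgroup l = (\<lambda>j::nat. r [^]\<^bsub>GL\<^esub> j) ` {..<?e}"
    "\<And>k. z ^ k = 1 \<longleftrightarrow> ?e dvd k" "(of_nat ?e :: 'a) \<noteq> 0" "GL.ord r = ?e"
    using fixing_subgroup_cyclic[OF l] by metis
  have "l ^ i dvd (\<Sum>j<?e. const_fun (inverse z ^ (i * j)) * G (r [^]\<^bsub>GL\<^esub> j))" if i: "i < ?e" for i
  proof (rule linear_form_power_dvd_cancel[OF l p])
    have "r [^]\<^bsub>GL\<^esub> ?e = \<one>\<^bsub>GL\<^esub>"
      using fixing_subgroup_in_W[OF r(1)] r(6) by (metis GL.pow_ord_eq_1 in_GL)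
    then have "l ^ i dvd (\<Sum>j<?e. const_fun (inverse z ^ (i * j)) *
        localization_lift (fixing_subgroup l) c (r [^]\<^bsub>GL\<^esub> j))"
      using r(4) by (intro tensor_transform_dvd[OF l r(1,2) _ _ _ i]) (auto dest: dvd_imp_le)
    moreover have "const_fun (inverse z ^ (i * j)) * localization_lift (fixing_subgroup l) c (r [^]\<^bsub>GL\<^esub> j) =
        p * (const_fun (inverse z ^ (i * j)) * G (r [^]\<^bsub>GL\<^esub> j))" for j
      by (metis c fixing_subgroup_pow[OF r(1)] mult.left_commute)
    ultimately show "l ^ i dvd p * (\<Sum>j<?e. const_fun (inverse z ^ (i * j)) * G (r [^]\<^bsub>GL\<^esub> j))"
      by (simp only: sum_distrib_left)
  qed
  then show ?thesis by (rule tensor_of_transform_dvd[OF l r(1-5)])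
qed

end

lemma to_fract_power: "to_fract (f ^ k) = to_fract f ^ k"
  by (induct k) simp_all

section \<open>The defining conditions as a local condition\<close>

text \<open>The values \<open>z\<^sup>j p\<close> stand for those of the co-root map along a coset of a cyclic group, so that all
  summands have the common denominator \<open>p\<^sup>i\<close>. For negative \<open>i\<close> there is no denominator.\<close>

lemma quotient_sum_in_range_iff:
  fixes p :: "('a::alg_closed_field, 'n::finite) polyfun"
  assumes p: "p \<noteq> 0" and z: "z \<noteq> 0"
  shows "(\<forall>i::int. i \<le> int m - 1 \<longrightarrow>
      (\<Sum>j<m. to_fract (a j) / to_fract (const_fun (z ^ j) * p) powi i) \<in> range to_fract) \<longleftrightarrow>
    (\<forall>i<m. p ^ i dvd (\<Sum>j<m. const_fun (inverse z ^ (i * j)) * a j))"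
proof -
  have nonneg: "(\<Sum>j<m. to_fract (a j) / to_fract (const_fun (z ^ j) * p) powi int i) \<in> range to_fract \<longleftrightarrow>
      p ^ i dvd (\<Sum>j<m. const_fun (inverse z ^ (i * j)) * a j)" for i
  proof -
    have pi: "to_fract (p ^ i) \<noteq> 0" using p by simp
    have "to_fract (a j) / to_fract (const_fun (z ^ j) * p) powi int i =
        to_fract (const_fun (inverse z ^ (i * j)) * a j) / to_fract (p ^ i)" for j
    proof -
      have "(z ^ j) ^ i * inverse z ^ (i * j) = 1"
        using z by (simp add: mult.commute[of i] power_mult flip: power_mult_distrib)
      then have "to_fract (const_fun (z ^ j) ^ i) * to_fract (const_fun (inverse z ^ (i * j)) :: ('a, 'n) polyfun) = 1"
        by (simp flip: const_fun_power const_fun_mult to_fract_mult)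
      then have unit: "to_fract (const_fun (z ^ j) ^ i :: ('a, 'n) polyfun) =
          1 / to_fract (const_fun (inverse z ^ (i * j)))"
        by (metis mult_zero_right nonzero_eq_divide_eq zero_neq_one)
      have "to_fract (a j) / to_fract (const_fun (z ^ j) * p) powi int i =
          to_fract (a j) / (to_fract (const_fun (z ^ j) ^ i) * to_fract (p ^ i))"
        by (simp add: to_fract_power power_mult_distrib)
      then show ?thesis by (simp add: unit mult.commute)
    qed
    then have "(\<Sum>j<m. to_fract (a j) / to_fract (const_fun (z ^ j) * p) powi int i) =
        to_fract (\<Sum>j<m. const_fun (inverse z ^ (i * j)) * a j) / to_fract (p ^ i)"
      by (simp only: to_fract_sum sum_divide_distrib)
    also have "\<dots> \<in> range to_fract \<longleftrightarrow> p ^ i dvd (\<Sum>j<m. const_fun (inverse z ^ (i * j)) * a j)" (is "?Q \<longleftrightarrow> _ dvd ?S")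
    proof
      assume ?Q
      then obtain b where "to_fract ?S / to_fract (p ^ i) = to_fract b" by blast
      then have "to_fract ?S = to_fract (p ^ i * b)" using pi by (simp add: field_simps)
      then have "?S = p ^ i * b" by (simp only: to_fract_eq_iff)
      then show "p ^ i dvd ?S" by simp
    next
      assume "p ^ i dvd ?S"
      then obtain b where "?S = p ^ i * b" by (auto simp: dvd_def)
      then have "to_fract ?S / to_fract (p ^ i) = to_fract b" using pi by simp
      then show ?Q by simp
    qed
    finally show ?thesis .
  qed
  have neg: "(\<Sum>j<m. to_fract (a j) / to_fract (const_fun (z ^ j) * p) powi (- int k)) \<in> range to_fract" for k
  proof -
    have "to_fract (a j) / to_fract (const_fun (z ^ j) * p) powi (- int k) =
        to_fract (a j * (const_fun (z ^ j) * p) ^ k)" for j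
      by (simp add: power_int_minus to_fract_power field_simps)
    then have "(\<Sum>j<m. to_fract (a j) / to_fract (const_fun (z ^ j) * p) powi (- int k)) =
        to_fract (\<Sum>j<m. a j * (const_fun (z ^ j) * p) ^ k)"
      by (simp only: to_fract_sum)
    then show ?thesis by (metis rangeI)
  qed
  show ?thesis
  proof (intro iffI allI impI)
    fix i assume *: "\<forall>i::int. i \<le> int m - 1 \<longrightarrow>
      (\<Sum>j<m. to_fract (a j) / to_fract (const_fun (z ^ j) * p) powi i) \<in> range to_fract" and "i < m"
    then show "p ^ i dvd (\<Sum>j<m. const_fun (inverse z ^ (i * j)) * a j)"
      using nonneg[of i] *[rule_format, of "int i"] by simp
  next
    fix i :: int
    assume *: "\<forall>i<m. p ^ i dvd (\<Sum>j<m. const_fun (inverse z ^ (i * j)) * a j)" and i: "i \<le> int m - 1"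
    show "(\<Sum>j<m. to_fract (a j) / to_fract (const_fun (z ^ j) * p) powi i) \<in> range to_fract"
    proof (cases "i \<ge> 0")
      case True
      then obtain k where "i = int k" using nonneg_int_cases by blast
      then show ?thesis using nonneg[of k] * i by simp
    next
      case False
      then obtain k where "i = - int k" by (metis int_cases2 of_nat_0_le_iff)
      then show ?thesis using neg by simp
    qed
  qed
qed

context finite_linear_group
begin

text \<open>The condition that \<open>F\<close> is in the image of the localization map after restriction to any coset of
  the stabilizer of a hyperplane. Ranging over all hyperplanes, reflecting or
  not, makes the condition visibly stable under translation by \<open>W\<close>.\<close>

definition locally_tensor :: "('a ^ 'n ^ 'n \<Rightarrow> ('a, 'n) polyfun) \<Rightarrow> bool" where
  "locally_tensor F \<longleftrightarrow> (\<forall>l. linear_form l \<longrightarrow> (\<forall>x\<in>W. \<exists>c. \<forall>w\<in>fixing_subgroup l.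
     F (w \<otimes>\<^bsub>GL\<^esub> x) = localization_lift (fixing_subgroup l) c w))"

lemma locally_tensorD:
  assumes "locally_tensor F" "linear_form l" "x \<in> W"
  obtains c where "\<And>w. w \<in> fixing_subgroup l \<Longrightarrow>
    F (w \<otimes>\<^bsub>GL\<^esub> x) = localization_lift (fixing_subgroup l) c w"
  using assms unfolding locally_tensor_def by blast

lemma conj_pow:
  assumes "x \<in> W" "s \<in> W"
  shows "(x \<otimes>\<^bsub>GL\<^esub> s \<otimes>\<^bsub>GL\<^esub> inv\<^bsub>GL\<^esub> x) [^]\<^bsub>GL\<^esub> (j::nat) = x \<otimes>\<^bsub>GL\<^esub> s [^]\<^bsub>GL\<^esub> j \<otimes>\<^bsub>GL\<^esub> inv\<^bsub>GL\<^esub> x"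
proof (induct j)
  case (Suc j)
  have "inv\<^bsub>GL\<^esub> x \<otimes>\<^bsub>GL\<^esub> (x \<otimes>\<^bsub>GL\<^esub> y) = y" if "y \<in> W" for y
    using assms that by (simp add: GL.m_assoc[symmetric])
  then show ?case using Suc assms by (simp add: GL.m_assoc)
qed (use assms in simp)

lemma coroot_scaling:
  assumes l: "linear_form l" and s: "s \<in> fixing_subgroup l" and z: "act s l = const_fun z * l"
  shows "z ^ k = 1 \<longleftrightarrow> s [^]\<^bsub>GL\<^esub> (k::nat) = \<one>\<^bsub>GL\<^esub>"
proof -
  have sW: "s \<in> W" using fixing_subgroup_in_W[OF s] .
  have pow: "act (s [^]\<^bsub>GL\<^esub> k) l = const_fun (z ^ k) * l" using act_pow_eigen[OF sW z] .
  show ?thesis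
  proof
    assume "z ^ k = 1"
    then show "s [^]\<^bsub>GL\<^esub> k = \<one>\<^bsub>GL\<^esub>"
      using fixing_subgroup_faithful[OF l fixing_subgroup_pow[OF s, of k]] pow by simp
  next
    assume "s [^]\<^bsub>GL\<^esub> k = \<one>\<^bsub>GL\<^esub>"
    then have eq: "const_fun (z ^ k) * l = l" using pow by simp
    obtain b where "eval l b = 1" using linear_form_normalized[OF l] .
    then show "z ^ k = 1" using arg_cong[OF eq, of "\<lambda>f. eval f b"] by (simp add: eval_simps)
  qed
qed

lemma ord_pos: "w \<in> W \<Longrightarrow> GL.ord w > 0"
proof -
  assume w: "w \<in> W"
  have "card W > 0" using card_W by (intro Nat.gr0I) auto
  then show ?thesis using pow_card_W[OF w] GL.ord_eq_0[of w] w by (metis gr0I in_GL)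
qed

lemma H_set_condition_iff:
  assumes co: "is_coroot s (l s)" and s: "s \<in> pseudo_reflections W" and x: "x \<in> W"
    and z: "act s (l s) = const_fun z * l s"
  shows "(\<forall>i::int. i \<le> int (GL.ord s) - 1 \<longrightarrow>
       (\<Sum>j<GL.ord s.
          to_fract (F (x \<otimes>\<^bsub>GL\<^esub> s [^]\<^bsub>GL\<^esub> j)) /
          to_fract (coroot_map l s (x \<otimes>\<^bsub>GL\<^esub> s [^]\<^bsub>GL\<^esub> j)) powi i) \<in> range to_fract) \<longleftrightarrow>
    (\<forall>i<GL.ord s. act x (l s) ^ i dvd
       (\<Sum>j<GL.ord s. const_fun (inverse z ^ (i * j)) * F (x \<otimes>\<^bsub>GL\<^esub> s [^]\<^bsub>GL\<^esub> j)))"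
proof -
  note l = coroot_fixing_subgroup(1,2)[OF s co]
  have sW: "s \<in> W" using fixing_subgroup_in_W[OF l(2)] .
  have "z ^ GL.ord s = 1" using coroot_scaling[OF l z] sW by simp
  then have z0: "z \<noteq> 0" using ord_pos[OF sW] by (metis gr_implies_not0 power_0_left zero_neq_one)
  have "coroot_map l s (x \<otimes>\<^bsub>GL\<^esub> s [^]\<^bsub>GL\<^esub> j) = const_fun (z ^ j) * act x (l s)" for j
    using x sW by (simp add: coroot_map_def act_act act_pow_eigen[OF sW z] act_mult)
  moreover have "act x (l s) \<noteq> 0" using linear_form_act[OF l(1)] x by (simp add: linear_form_def)
  ultimately show ?thesis using quotient_sum_in_range_iff[OF _ z0] by simp
qed

text \<open>A coset \<open>W\<^sub>m x\<close> of the stabilizer of a hyperplane is also \<open>x W\<^sub>k\<close> with \<open>k = x\<inverse>(m)\<close>, which matches the two sides.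
  The local condition at \<open>m\<close> follows from the defining condition for the single pseudo-reflection
  \<open>x\<inverse> r x\<close>, where \<open>r\<close> generates \<open>W\<^sub>m\<close>; conversely it implies the defining condition for all of
  the pseudo-reflections in \<open>x\<inverse> W\<^sub>m x\<close>.\<close>

lemma H_set_iff_locally_tensor:
  assumes co: "\<And>s. s \<in> pseudo_reflections W \<Longrightarrow> is_coroot s (l s)"
  shows "F \<in> H_set W l \<longleftrightarrow> F \<in> W \<rightarrow>\<^sub>E UNIV \<and> locally_tensor F"
proof (intro iffI conjI)
  assume F: "F \<in> H_set W l"
  then show "F \<in> W \<rightarrow>\<^sub>E UNIV" by (simp add: H_set_def)
  have H: "\<forall>i::int. i \<le> int (GL.ord s) - 1 \<longrightarrow>
       (\<Sum>j<GL.ord s.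
          to_fract (F (x \<otimes>\<^bsub>GL\<^esub> s [^]\<^bsub>GL\<^esub> j)) /
          to_fract (coroot_map l s (x \<otimes>\<^bsub>GL\<^esub> s [^]\<^bsub>GL\<^esub> j)) powi i) \<in> range to_fract"
    if "x \<in> W" "s \<in> pseudo_reflections W" for x s
    using F that unfolding H_set_def by blast
  show "locally_tensor F"
    unfolding locally_tensor_def
  proof (intro allI impI ballI)
    fix m :: "('a, 'n) polyfun" and x assume m: "linear_form m" and x: "x \<in> W"
    let ?e = "card (fixing_subgroup m)"
    obtain r z where r: "r \<in> fixing_subgroup m" "act r m = const_fun z * m"
      "fixing_subgroup m = (\<lambda>j::nat. r [^]\<^bsub>GL\<^esub> j) ` {..<?e}"
      "\<And>k. z ^ k = 1 \<longleftrightarrow> ?e dvd k" "(of_nat ?e :: 'a) \<noteq> 0" "GL.ord r = ?e"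
      using fixing_subgroup_cyclic[OF m] by metis
    have rW: "r \<in> W" using fixing_subgroup_in_W[OF r(1)] .
    show "\<exists>c. \<forall>w\<in>fixing_subgroup m. F (w \<otimes>\<^bsub>GL\<^esub> x) = localization_lift (fixing_subgroup m) c w"
    proof (cases "r = \<one>\<^bsub>GL\<^esub>")
      case True
      then have triv: "w = \<one>\<^bsub>GL\<^esub>" if "w \<in> fixing_subgroup m" for w using r(3) that by auto
      show ?thesis
        by (rule exI[of _ "frag_of (F x, 1)"], rule ballI, drule triv)
          (use x in \<open>simp add: localization_lift_frag_of\<close>)
    next
      case False
      define y where "y = inv\<^bsub>GL\<^esub> x"
      have y: "y \<in> W" "inv\<^bsub>GL\<^esub> y = x" using x by (simp_all add: y_def)
      \<comment> \<open>For this conjugate \<open>x t\<^sup>j = r\<^sup>j x\<close>, so the defining condition for \<open>t\<close> at \<open>x\<close> concerns the coset of \<open>x\<close>.\<close>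
      define t where "t = y \<otimes>\<^bsub>GL\<^esub> r \<otimes>\<^bsub>GL\<^esub> inv\<^bsub>GL\<^esub> y"
      have xt: "x \<otimes>\<^bsub>GL\<^esub> t [^]\<^bsub>GL\<^esub> j = r [^]\<^bsub>GL\<^esub> j \<otimes>\<^bsub>GL\<^esub> x" for j :: nat
        unfolding t_def conj_pow[OF y(1) rW] using x rW by (simp add: y_def GL.m_assoc[symmetric])
      have tW: "t \<in> W" using x y rW by (simp add: t_def)
      have t1: "t [^]\<^bsub>GL\<^esub> j = \<one>\<^bsub>GL\<^esub> \<longleftrightarrow> r [^]\<^bsub>GL\<^esub> j = \<one>\<^bsub>GL\<^esub>" for j :: nat
      proof -
        have "t [^]\<^bsub>GL\<^esub> j = \<one>\<^bsub>GL\<^esub> \<longleftrightarrow> x \<otimes>\<^bsub>GL\<^esub> t [^]\<^bsub>GL\<^esub> j = x" using x tW by simp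
        also have "\<dots> \<longleftrightarrow> r [^]\<^bsub>GL\<^esub> j = \<one>\<^bsub>GL\<^esub>" unfolding xt using x rW by simp
        finally show ?thesis .
      qed
      have "t \<noteq> \<one>\<^bsub>GL\<^esub>" using t1[of 1] False tW rW by simp
      define k where "k = act y m"
      have k: "linear_form k" using linear_form_act[OF m] y by (simp add: k_def)
      have tk: "t \<in> fixing_subgroup k"
        using fixing_subgroup_conj[OF r(1) x] y by (simp add: t_def k_def y_def)
      note t = fixing_subgroup_reflection[OF k tk \<open>t \<noteq> \<one>\<^bsub>GL\<^esub>\<close>]
      note lt = coroot_fixing_subgroup[OF t(1) co[OF t(1)]]
      have "{v. eval k v = 0} = {v. eval (l t) v = 0}"
        using lt(3) coroot_fixing_subgroup(3)[OF t] by simp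
      then obtain d where d: "d \<noteq> 0" "l t = const_fun d * k"
        using linear_forms_proportional[OF lt(1) k] by blast
      have xk: "act x k = m" using x by (simp add: k_def y_def flip: act_act)
      have "act t k = act (y \<otimes>\<^bsub>GL\<^esub> r) (act x (act y m))" using x y rW by (simp add: k_def t_def act_act)
      also have "\<dots> = const_fun z * k" using x y rW xk by (simp add: k_def act_act act_mult r(2))
      finally have "act t (l t) = const_fun z * l t" by (simp add: d act_mult mult_ac)
      note cond = H_set_condition_iff[where l = l and F = F, OF co[OF t(1)] t(1) x this]
      have "GL.ord t = ?e"
        using GL.ord_unique[of t ?e] tW t1 coroot_scaling[OF m r(1,2)] r(4) by simp
      moreover have "act x (l t) = const_fun d * m" by (simp add: d act_mult xk)
      ultimately have scaled: "\<forall>i<?e. (const_fun d * m) ^ i dvd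
          (\<Sum>j<?e. const_fun (inverse z ^ (i * j)) * F (r [^]\<^bsub>GL\<^esub> j \<otimes>\<^bsub>GL\<^esub> x))"
        using cond[THEN iffD1, OF H[OF x t(1)]] by (simp add: xt)
      have "m ^ i dvd (\<Sum>j<?e. const_fun (inverse z ^ (i * j)) * F (r [^]\<^bsub>GL\<^esub> j \<otimes>\<^bsub>GL\<^esub> x))"
        if "i < ?e" for i
      proof (rule dvd_trans)
        show "m ^ i dvd (const_fun d * m) ^ i" by (simp add: power_mult_distrib)
      qed (use scaled that in blast)
      then show ?thesis by (rule tensor_of_transform_dvd[OF m r(1-5)])
    qed
  qed
next
  assume "F \<in> W \<rightarrow>\<^sub>E UNIV \<and> locally_tensor F"
  then have ext: "F \<in> W \<rightarrow>\<^sub>E UNIV" and loc: "locally_tensor F" by auto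
  have "\<forall>i::int. i \<le> int (GL.ord s) - 1 \<longrightarrow>
       (\<Sum>j<GL.ord s.
          to_fract (F (x \<otimes>\<^bsub>GL\<^esub> s [^]\<^bsub>GL\<^esub> j)) /
          to_fract (coroot_map l s (x \<otimes>\<^bsub>GL\<^esub> s [^]\<^bsub>GL\<^esub> j)) powi i) \<in> range to_fract"
    if x: "x \<in> W" and s: "s \<in> pseudo_reflections W" for x s
  proof -
    note ls = coroot_fixing_subgroup(1,2)[OF s co[OF s]]
    have sW: "s \<in> W" using fixing_subgroup_in_W[OF ls(2)] .
    obtain z where z: "act s (l s) = const_fun z * l s" using fixing_subgroup_scales[OF ls] .
    define m where "m = act x (l s)"
    have m: "linear_form m" using linear_form_act[OF ls(1)] x by (simp add: m_def)
    define t where "t = x \<otimes>\<^bsub>GL\<^esub> s \<otimes>\<^bsub>GL\<^esub> inv\<^bsub>GL\<^esub> x"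
    have tm: "t \<in> fixing_subgroup m"
      using fixing_subgroup_conj[OF ls(2), of "inv\<^bsub>GL\<^esub> x"] x by (simp add: t_def m_def)
    have tpow: "t [^]\<^bsub>GL\<^esub> j \<otimes>\<^bsub>GL\<^esub> x = x \<otimes>\<^bsub>GL\<^esub> s [^]\<^bsub>GL\<^esub> j" for j :: nat
      unfolding t_def conj_pow[OF x sW] using x sW by (simp add: GL.m_assoc)
    have xm: "act (inv\<^bsub>GL\<^esub> x) m = l s" using x by (simp add: m_def flip: act_act)
    have "act t m = act (x \<otimes>\<^bsub>GL\<^esub> s) (act (inv\<^bsub>GL\<^esub> x) m)" using x sW by (simp add: t_def act_act)
    also have "\<dots> = const_fun z * m" unfolding xm using x sW by (simp add: act_act z act_mult m_def)
    finally have tz: "act t m = const_fun z * m" .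
    obtain c where c: "\<And>w. w \<in> fixing_subgroup m \<Longrightarrow>
        F (w \<otimes>\<^bsub>GL\<^esub> x) = localization_lift (fixing_subgroup m) c w"
      using locally_tensorD[OF loc m x] by blast
    have zk: "z ^ k = 1 \<longleftrightarrow> GL.ord s dvd k" for k
      using coroot_scaling[OF ls z, of k] GL.pow_eq_id[of s k] sW by simp
    have "m ^ i dvd (\<Sum>j<GL.ord s. const_fun (inverse z ^ (i * j)) *
        localization_lift (fixing_subgroup m) c (t [^]\<^bsub>GL\<^esub> j))" if i: "i < GL.ord s" for i
    proof (rule tensor_transform_dvd[OF m tm tz _ _ _ i])
      show "z ^ k \<noteq> 1" if "0 < k" "k < GL.ord s" for k using that zk by (auto dest: dvd_imp_le)
      show "z ^ GL.ord s = 1" using zk by simp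
      then show "t [^]\<^bsub>GL\<^esub> GL.ord s = \<one>\<^bsub>GL\<^esub>" using coroot_scaling[OF m tm tz] by simp
    qed
    moreover have "localization_lift (fixing_subgroup m) c (t [^]\<^bsub>GL\<^esub> j) = F (x \<otimes>\<^bsub>GL\<^esub> s [^]\<^bsub>GL\<^esub> j)" for j :: nat
      using c[OF fixing_subgroup_pow[OF tm, of j]] by (simp only: tpow)
    ultimately show ?thesis
      using H_set_condition_iff[where l = l and F = F, OF co[OF s] s x z] by (simp add: m_def)
  qed
  then show "F \<in> H_set W l" using ext by (simp add: H_set_def)
qed

end

lemma map_left_id: "map_left (\<lambda>f. f) c = c"
  by (induct c rule: frag_pair_induct) (simp_all add: map_left_diff)

lemma keys_map_left: "Poly_Mapping.keys (map_left \<phi> c) \<subseteq> (\<lambda>(f, g). (\<phi> f, g)) ` Poly_Mapping.keys c"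
  unfolding map_left_def using keys_frag_extend by (fastforce split: prod.splits)

section \<open>Divided differences\<close>

locale reflection_group = finite_linear_group W
  for W :: "('a::alg_closed_field ^ 'n::finite ^ 'n) set" +
  fixes l :: "'a ^ 'n ^ 'n \<Rightarrow> ('a, 'n) polyfun"
  assumes generated: "generate GL (pseudo_reflections W) = W"
    and coroot: "s \<in> pseudo_reflections W \<Longrightarrow> is_coroot s (l s)"
begin

lemma coroot_form: "s \<in> pseudo_reflections W \<Longrightarrow> linear_form (l s)"
  and reflection_in_fixing_subgroup: "s \<in> pseudo_reflections W \<Longrightarrow> s \<in> fixing_subgroup (l s)"
  using coroot_fixing_subgroup coroot by blast+

lemma reflection_in_W: "s \<in> pseudo_reflections W \<Longrightarrow> s \<in> W"
  by (simp add: pseudo_reflections_def)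

lemma coroot_nonzero: "s \<in> pseudo_reflections W \<Longrightarrow> l s \<noteq> 0"
  using coroot_form by (simp add: linear_form_def)

text \<open>The operator \<open>\<Delta>\<^sub>s f = (s(f) - f) / l\<^sub>s\<close>; see \<open>divided_difference\<close> for the exactness of the division.\<close>

definition divided_difference :: "'a ^ 'n ^ 'n \<Rightarrow> ('a, 'n) polyfun \<Rightarrow> ('a, 'n) polyfun" where
  "divided_difference s f = (SOME g. act s f - f = l s * g)"

lemma divided_difference:
  assumes "s \<in> pseudo_reflections W"
  shows "l s * divided_difference s f = act s f - f"
proof -
  have "\<exists>g. act s f - f = l s * g"
    using fixing_subgroup_act_dvd[OF coroot_form reflection_in_fixing_subgroup] assms by (simp add: dvd_def)
  then show ?thesis unfolding divided_difference_def by (metis (mono_tags, lifting) someI_ex)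
qed

text \<open>The operator \<open>\<Delta>\<^sub>s \<otimes> 1\<close> on tensors corresponds to \<open>F \<mapsto> (sF - F) / l\<^sub>s\<close> on maps. The domain \<open>U\<close> is
  arbitrary because this is used both for \<open>W\<close> and for stabilizers of hyperplanes.\<close>

lemma localization_lift_divided_difference:
  assumes s: "s \<in> pseudo_reflections W" and w: "w \<in> W" "w \<in> U" "inv\<^bsub>GL\<^esub> s \<otimes>\<^bsub>GL\<^esub> w \<in> U"
  shows "l s * localization_lift U (map_left (divided_difference s) c) w =
    act s (localization_lift U c (inv\<^bsub>GL\<^esub> s \<otimes>\<^bsub>GL\<^esub> w)) - localization_lift U c w"
proof -
  have "l s * localization_lift U (map_left (divided_difference s) c) w =
      localization_lift U (map_left (\<lambda>f. act s f - f) c) w"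
    using w by (simp add: localization_lift_scale[symmetric] map_left_map_left divided_difference[OF s])
  also have "\<dots> = localization_lift U (map_left (act s) c) w - localization_lift U c w"
    using localization_lift_map_left_diff[OF w(2), of "act s" "\<lambda>f. f" c] by (simp add: map_left_id)
  also have "localization_lift U (map_left (act s) c) w =
      act s (localization_lift U c (inv\<^bsub>GL\<^esub> s \<otimes>\<^bsub>GL\<^esub> w))"
    using w reflection_in_W[OF s] by (intro localization_lift_act) simp_all
  finally show ?thesis .
qed

lemma locally_tensor_divided_difference_fixing:
  assumes s: "s \<in> pseudo_reflections W" "s \<in> fixing_subgroup m"
    and c: "\<And>w. w \<in> fixing_subgroup m \<Longrightarrow>
      F (w \<otimes>\<^bsub>GL\<^esub> x) = localization_lift (fixing_subgroup m) c w"
    and x: "x \<in> W" and w: "w \<in> fixing_subgroup m"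
  shows "act s (F (inv\<^bsub>GL\<^esub> s \<otimes>\<^bsub>GL\<^esub> (w \<otimes>\<^bsub>GL\<^esub> x))) - F (w \<otimes>\<^bsub>GL\<^esub> x) =
    l s * localization_lift (fixing_subgroup m) (map_left (divided_difference s) c) w"
proof -
  have "inv\<^bsub>GL\<^esub> s \<otimes>\<^bsub>GL\<^esub> w \<in> fixing_subgroup m"
    using s w by (intro fixing_subgroup_mult fixing_subgroup_inv)
  then show ?thesis
    using c[OF w] c[of "inv\<^bsub>GL\<^esub> s \<otimes>\<^bsub>GL\<^esub> w"] fixing_subgroup_in_W[OF w] reflection_in_W[OF s(1)] x w
    by (simp add: localization_lift_divided_difference[OF s(1)] GL.m_assoc)
qed

lemma locally_tensor_divided_difference_exists:
  assumes F: "locally_tensor F" and s: "s \<in> pseudo_reflections W"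
  obtains G where "\<And>x. x \<in> W \<Longrightarrow> l s * G x = act s (F (inv\<^bsub>GL\<^esub> s \<otimes>\<^bsub>GL\<^esub> x)) - F x"
proof -
  have "\<exists>g. l s * g = act s (F (inv\<^bsub>GL\<^esub> s \<otimes>\<^bsub>GL\<^esub> x)) - F x" if x: "x \<in> W" for x
  proof -
    obtain c where c: "\<And>w. w \<in> fixing_subgroup (l s) \<Longrightarrow>
        F (w \<otimes>\<^bsub>GL\<^esub> x) = localization_lift (fixing_subgroup (l s)) c w"
      using locally_tensorD[OF F coroot_form[OF s] x] by blast
    from locally_tensor_divided_difference_fixing[OF s reflection_in_fixing_subgroup[OF s] c x
        fixing_subgroup_one] x
    show ?thesis by auto
  qed
  then show ?thesis using that by metis
qed

text \<open>The condition at \<open>m\<close> for the translated map is the condition at \<open>s\<inverse>(m)\<close> for \<open>F\<close>, transported by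
  \<open>f \<otimes> g \<mapsto> s(f) \<otimes> s(g)\<close>.\<close>

lemma locally_tensor_translate:
  assumes F: "locally_tensor F" and s: "s \<in> W" and m: "linear_form m" and x: "x \<in> W"
  obtains d where "\<And>w. w \<in> fixing_subgroup m \<Longrightarrow>
    act s (F (inv\<^bsub>GL\<^esub> s \<otimes>\<^bsub>GL\<^esub> (w \<otimes>\<^bsub>GL\<^esub> x))) = localization_lift (fixing_subgroup m) d w"
proof -
  let ?m = "act (inv\<^bsub>GL\<^esub> s) m" and ?conj = "\<lambda>w. inv\<^bsub>GL\<^esub> s \<otimes>\<^bsub>GL\<^esub> w \<otimes>\<^bsub>GL\<^esub> s"
  have m': "linear_form ?m" using linear_form_act[OF m] s by simp
  obtain c where c: "\<And>w. w \<in> fixing_subgroup ?m \<Longrightarrow>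
      F (w \<otimes>\<^bsub>GL\<^esub> (inv\<^bsub>GL\<^esub> s \<otimes>\<^bsub>GL\<^esub> x)) = localization_lift (fixing_subgroup ?m) c w"
    by (rule locally_tensorD[OF F m', of "inv\<^bsub>GL\<^esub> s \<otimes>\<^bsub>GL\<^esub> x"]) (use s x in auto)
  have conj: "?conj w \<in> fixing_subgroup ?m" if "w \<in> fixing_subgroup m" for w
    using fixing_subgroup_conj[OF that s] .
  have "\<exists>d. \<forall>w\<in>fixing_subgroup m.
      act s (localization_lift (fixing_subgroup ?m) c (?conj w)) = localization_lift (fixing_subgroup m) d w"
  proof (induct c rule: frag_pair_induct)
    case zero
    show ?case by (rule exI[of _ 0]) (simp add: localization_lift_0 conj)
  next
    case (one f g)
    have "act s (act (?conj w) g) = act w (act s g)" if "w \<in> fixing_subgroup m" for w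
    proof -
      have "s \<otimes>\<^bsub>GL\<^esub> ?conj w = w \<otimes>\<^bsub>GL\<^esub> s"
        using s fixing_subgroup_in_W[OF that] by (simp add: GL.m_assoc[symmetric])
      then have "act (s \<otimes>\<^bsub>GL\<^esub> ?conj w) g = act (w \<otimes>\<^bsub>GL\<^esub> s) g" by simp
      moreover have "act (s \<otimes>\<^bsub>GL\<^esub> ?conj w) g = act s (act (?conj w) g)"
        using s fixing_subgroup_in_W[OF that] by (intro act_act) simp_all
      moreover have "act (w \<otimes>\<^bsub>GL\<^esub> s) g = act w (act s g)"
        using s fixing_subgroup_in_W[OF that] by (intro act_act) simp_all
      ultimately show ?thesis by simp
    qed
    then show ?case
      by (intro exI[of _ "frag_of (act s f, act s g)"])
        (simp add: localization_lift_frag_of conj act_mult)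
  next
    case (diff c d)
    then obtain c' d' where
      "\<forall>w\<in>fixing_subgroup m. act s (localization_lift (fixing_subgroup ?m) c (?conj w)) =
        localization_lift (fixing_subgroup m) c' w"
      "\<forall>w\<in>fixing_subgroup m. act s (localization_lift (fixing_subgroup ?m) d (?conj w)) =
        localization_lift (fixing_subgroup m) d' w" by blast
    then show ?case
      by (intro exI[of _ "c' - d'"]) (simp add: localization_lift_diff conj act_diff)
  qed
  then obtain d where d: "\<And>w. w \<in> fixing_subgroup m \<Longrightarrow>
      act s (localization_lift (fixing_subgroup ?m) c (?conj w)) = localization_lift (fixing_subgroup m) d w"
    by blast
  have "act s (F (inv\<^bsub>GL\<^esub> s \<otimes>\<^bsub>GL\<^esub> (w \<otimes>\<^bsub>GL\<^esub> x))) = localization_lift (fixing_subgroup m) d w"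
    if w: "w \<in> fixing_subgroup m" for w
  proof -
    have "s \<otimes>\<^bsub>GL\<^esub> (inv\<^bsub>GL\<^esub> s \<otimes>\<^bsub>GL\<^esub> x) = x" using s x by (simp add: GL.m_assoc[symmetric])
    then have "?conj w \<otimes>\<^bsub>GL\<^esub> (inv\<^bsub>GL\<^esub> s \<otimes>\<^bsub>GL\<^esub> x) = inv\<^bsub>GL\<^esub> s \<otimes>\<^bsub>GL\<^esub> (w \<otimes>\<^bsub>GL\<^esub> x)"
      using s x fixing_subgroup_in_W[OF w] by (simp add: GL.m_assoc)
    then show ?thesis using c[OF conj[OF w]] d[OF w] by simp
  qed
  then show ?thesis using that by blast
qed

text \<open>If \<open>l\<^sub>s\<close> vanishes on the hyperplane \<open>m = 0\<close>, then \<open>s\<close> belongs to its stabilizer and \<open>\<Delta>\<^sub>s \<otimes> 1\<close> applied to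
  the local tensor of \<open>F\<close> represents \<open>G\<close>. Otherwise \<open>l\<^sub>s G\<close> is locally a tensor as a difference of two
  such maps, and \<open>l\<^sub>s\<close> can be cancelled.\<close>

lemma locally_tensor_divided_difference:
  assumes F: "locally_tensor F" and s: "s \<in> pseudo_reflections W"
    and G: "\<And>x. x \<in> W \<Longrightarrow> l s * G x = act s (F (inv\<^bsub>GL\<^esub> s \<otimes>\<^bsub>GL\<^esub> x)) - F x"
  shows "locally_tensor G"
  unfolding locally_tensor_def
proof (intro allI impI ballI)
  fix m :: "('a, 'n) polyfun" and x assume m: "linear_form m" and x: "x \<in> W"
  obtain c where c: "\<And>w. w \<in> fixing_subgroup m \<Longrightarrow>
      F (w \<otimes>\<^bsub>GL\<^esub> x) = localization_lift (fixing_subgroup m) c w"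
    using locally_tensorD[OF F m x] by blast
  have Gw: "l s * G (w \<otimes>\<^bsub>GL\<^esub> x) = act s (F (inv\<^bsub>GL\<^esub> s \<otimes>\<^bsub>GL\<^esub> (w \<otimes>\<^bsub>GL\<^esub> x))) - F (w \<otimes>\<^bsub>GL\<^esub> x)"
    if "w \<in> fixing_subgroup m" for w
    using that x fixing_subgroup_in_W by (intro G) simp
  show "\<exists>d. \<forall>w\<in>fixing_subgroup m. G (w \<otimes>\<^bsub>GL\<^esub> x) = localization_lift (fixing_subgroup m) d w"
  proof (cases "\<exists>u. eval m u = 0 \<and> eval (l s) u \<noteq> 0")
    case True
    then obtain u where u: "eval m u = 0" "eval (l s) u \<noteq> 0" by blast
    obtain d where d: "\<And>w. w \<in> fixing_subgroup m \<Longrightarrow>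
        act s (F (inv\<^bsub>GL\<^esub> s \<otimes>\<^bsub>GL\<^esub> (w \<otimes>\<^bsub>GL\<^esub> x))) = localization_lift (fixing_subgroup m) d w"
      using locally_tensor_translate[OF F reflection_in_W[OF s] m x] by blast
    have "l s * G (w \<otimes>\<^bsub>GL\<^esub> x) = localization_lift (fixing_subgroup m) (d - c) w"
      if "w \<in> fixing_subgroup m" for w
      using that by (simp add: Gw c d localization_lift_diff)
    then show ?thesis by (rule tensor_saturated[OF m u])
  next
    case False
    then have sm: "s \<in> fixing_subgroup m"
      using reflection_in_fixing_subgroup[OF s] by (auto simp: fixing_subgroup_def)
    have "l s * G (w \<otimes>\<^bsub>GL\<^esub> x) =
        l s * localization_lift (fixing_subgroup m) (map_left (divided_difference s) c) w"
      if w: "w \<in> fixing_subgroup m" for w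
      unfolding Gw[OF w] by (rule locally_tensor_divided_difference_fixing[OF s sm c x w])
    then show ?thesis using coroot_nonzero[OF s] by (metis mult_left_cancel)
  qed
qed

section \<open>Degree along generic lines\<close>

text \<open>Directions transversal to all reflecting hyperplanes. Quantifying over \<open>W\<close> makes the set \<open>W\<close>-stable,
  so that degrees measured along these directions are \<open>W\<close>-invariant.\<close>

definition generic_direction :: "'a ^ 'n \<Rightarrow> bool" where
  "generic_direction v \<longleftrightarrow> (\<forall>w\<in>W. \<forall>s\<in>pseudo_reflections W. eval (l s) (w *v v) \<noteq> 0)"

text \<open>Along a generic line a co-root restricts to a polynomial of degree exactly one, so dividing by it
  lowers this degree by one; with the usual total degree the same would require a decomposition
  into homogeneous parts. The bound is strict so that \<open>d = 0\<close> singles out the zero function, which is the base of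
  the induction.\<close>

definition degree_below :: "nat \<Rightarrow> ('a, 'n) polyfun \<Rightarrow> bool" where
  "degree_below d f \<longleftrightarrow> (\<forall>u v. generic_direction v \<longrightarrow>
     (\<exists>p. (\<forall>t. eval f (u + t *s v) = poly p t) \<and> (\<forall>k\<ge>d. coeff p k = 0)))"

text \<open>The product of all \<open>W\<close>-translates of all co-roots is a non-zero polynomial function.\<close>

lemma generic_direction_exists: "\<exists>v. generic_direction v"
proof -
  have fin: "finite (pseudo_reflections W)"
    using finite_W by (rule finite_subset[rotated]) (auto simp: pseudo_reflections_def)
  have "(\<Prod>w\<in>W. \<Prod>s\<in>pseudo_reflections W. act (inv\<^bsub>GL\<^esub> w) (l s)) \<noteq> 0"
    using finite_W fin linear_form_act[OF coroot_form] by (auto simp: linear_form_def)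
  then obtain v where "eval (\<Prod>w\<in>W. \<Prod>s\<in>pseudo_reflections W. act (inv\<^bsub>GL\<^esub> w) (l s)) v \<noteq> 0"
    by (auto simp: eval_inject_iff eval_simps)
  then have "generic_direction v"
    using finite_W fin by (auto simp: generic_direction_def eval_prod act.rep_eq)
  then show ?thesis by blast
qed

lemma degree_below_exists: "\<exists>d. degree_below d f"
proof -
  have "\<exists>n. \<forall>u v. \<exists>p. (\<forall>t. F (u + t *s v) = poly p t) \<and> degree p \<le> n" if "F \<in> poly_funs" for F :: "'a ^ 'n \<Rightarrow> 'a"
    using that
  proof (induction rule: poly_funs.induct)
    case (const c)
    show ?case by (rule exI[of _ 0], intro allI, rule exI[of _ "[:c:]"]) simp
  next
    case (coord k)
    show ?case
    proof (rule exI[of _ 1], intro allI)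
      fix u v :: "'a ^ 'n"
      show "\<exists>p. (\<forall>t. (u + t *s v) $ k = poly p t) \<and> degree p \<le> 1"
        by (rule exI[of _ "[:u $ k, v $ k:]"]) simp
    qed
  next
    case (add F G)
    then obtain a b where a: "\<forall>u v. \<exists>p. (\<forall>t. F (u + t *s v) = poly p t) \<and> degree p \<le> a"
      and b: "\<forall>u v. \<exists>p. (\<forall>t. G (u + t *s v) = poly p t) \<and> degree p \<le> b" by blast
    show ?case
    proof (rule exI[of _ "max a b"], intro allI)
      fix u v
      obtain p q where "\<forall>t. F (u + t *s v) = poly p t" "degree p \<le> a"
        "\<forall>t. G (u + t *s v) = poly q t" "degree q \<le> b" using a b by metis
      then show "\<exists>p. (\<forall>t. F (u + t *s v) + G (u + t *s v) = poly p t) \<and> degree p \<le> max a b"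
        by (intro exI[of _ "p + q"]) (auto intro: degree_add_le)
    qed
  next
    case (mult F G)
    then obtain a b where a: "\<forall>u v. \<exists>p. (\<forall>t. F (u + t *s v) = poly p t) \<and> degree p \<le> a"
      and b: "\<forall>u v. \<exists>p. (\<forall>t. G (u + t *s v) = poly p t) \<and> degree p \<le> b" by blast
    show ?case
    proof (rule exI[of _ "a + b"], intro allI)
      fix u v
      obtain p q where "\<forall>t. F (u + t *s v) = poly p t" "degree p \<le> a"
        "\<forall>t. G (u + t *s v) = poly q t" "degree q \<le> b" using a b by metis
      then show "\<exists>p. (\<forall>t. F (u + t *s v) * G (u + t *s v) = poly p t) \<and> degree p \<le> a + b"
        by (intro exI[of _ "p * q"]) (auto intro: order_trans[OF degree_mult_le add_mono])
    qed
  qed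
  from this[OF eval] obtain n where n: "\<forall>u v. \<exists>p. (\<forall>t. eval f (u + t *s v) = poly p t) \<and> degree p \<le> n"
    by blast
  have "degree_below (Suc n) f"
    unfolding degree_below_def
  proof (intro allI impI)
    fix u v
    obtain p where p: "\<forall>t. eval f (u + t *s v) = poly p t" "degree p \<le> n" using n by blast
    then have "\<forall>k\<ge>Suc n. coeff p k = 0" by (auto intro!: coeff_eq_0)
    with p(1) show "\<exists>p. (\<forall>t. eval f (u + t *s v) = poly p t) \<and> (\<forall>k\<ge>Suc n. coeff p k = 0)" by blast
  qed
  then show ?thesis by blast
qed

lemma degree_below_mono: "degree_below d f \<Longrightarrow> d \<le> d' \<Longrightarrow> degree_below d' f"
  unfolding degree_below_def by (meson le_trans)

lemma degree_below_diff:
  assumes "degree_below d f" "degree_below d g"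
  shows "degree_below d (f - g)"
  unfolding degree_below_def
proof (intro allI impI)
  fix u v assume v: "generic_direction v"
  obtain p q where "\<forall>t. eval f (u + t *s v) = poly p t" "\<forall>k\<ge>d. coeff p k = 0"
    "\<forall>t. eval g (u + t *s v) = poly q t" "\<forall>k\<ge>d. coeff q k = 0"
    using assms v unfolding degree_below_def by metis
  then show "\<exists>p. (\<forall>t. eval (f - g) (u + t *s v) = poly p t) \<and> (\<forall>k\<ge>d. coeff p k = 0)"
    by (intro exI[of _ "p - q"]) (simp add: eval_simps)
qed

lemma degree_below_act:
  assumes f: "degree_below d f" and w: "w \<in> W"
  shows "degree_below d (act w f)"
  unfolding degree_below_def
proof (intro allI impI)
  fix u v assume v: "generic_direction v"
  have "generic_direction (inv\<^bsub>GL\<^esub> w *v v)"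
    using v w by (auto simp: generic_direction_def simp flip: GL_mult_vec)
  moreover have "eval (act w f) (u + t *s v) = eval f (inv\<^bsub>GL\<^esub> w *v u + t *s (inv\<^bsub>GL\<^esub> w *v v))" for t
    by (simp add: act.rep_eq matrix_vector_right_distrib vector_scalar_commute)
  ultimately show "\<exists>p. (\<forall>t. eval (act w f) (u + t *s v) = poly p t) \<and> (\<forall>k\<ge>d. coeff p k = 0)"
    using f unfolding degree_below_def by simp
qed

lemma degree_below_cancel:
  assumes f: "degree_below (Suc d) (l s * g)" and s: "s \<in> pseudo_reflections W"
  shows "degree_below d g"
  unfolding degree_below_def
proof (intro allI impI)
  fix u v assume v: "generic_direction v"
  obtain p where p: "\<And>t. eval (l s * g) (u + t *s v) = poly p t" "\<And>k. k \<ge> Suc d \<Longrightarrow> coeff p k = 0"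
    using f v unfolding degree_below_def by blast
  obtain q where q: "\<And>t. eval g (u + t *s v) = poly q t" using poly_funs_on_line[OF eval] by blast
  define a where "a = eval (l s) v"
  have "eval (l s) (\<one>\<^bsub>GL\<^esub> *v v) \<noteq> 0"
    using v s one_in_W unfolding generic_direction_def by blast
  then have a: "a \<noteq> 0" by (simp add: a_def)
  let ?L = "[:eval (l s) u, a:]"
  have "poly (p - ?L * q) t = 0" for t
    using p(1)[of t] q[of t] by (simp add: eval_simps linear_form_simps[OF coroot_form[OF s]] a_def algebra_simps)
  then have "p - ?L * q = 0" by (rule poly_eq_0_of_values)
  then have pq: "p = ?L * q" by simp
  have "coeff q k = 0" if "k \<ge> d" for k
  proof (cases "q = 0")
    case False
    then have "degree p = Suc (degree q)" using a by (simp add: pq degree_mult_eq del: mult_pCons_left)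
    moreover have "p \<noteq> 0" using False a by (simp add: pq del: mult_pCons_left)
    ultimately have "coeff p (Suc (degree q)) \<noteq> 0" by (metis leading_coeff_0_iff)
    then have "\<not> Suc (degree q) \<ge> Suc d" using p(2) by blast
    then show ?thesis using that by (intro coeff_eq_0) simp
  qed simp
  then show "\<exists>p. (\<forall>t. eval g (u + t *s v) = poly p t) \<and> (\<forall>k\<ge>d. coeff p k = 0)" using q by blast
qed

lemma degree_below_0:
  assumes "degree_below 0 f"
  shows "f = 0"
proof -
  obtain v where v: "generic_direction v" using generic_direction_exists by blast
  have "eval f u = 0" for u
  proof -
    obtain p where p: "\<forall>t. eval f (u + t *s v) = poly p t" "\<forall>k\<ge>0. coeff p k = 0"
      using assms v unfolding degree_below_def by meson
    then have "p = 0" by (simp add: poly_eq_iff)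
    then show ?thesis using p(1)[rule_format, of 0] by simp
  qed
  then show ?thesis by (simp add: eval_inject_iff eval_simps)
qed

lemma degree_below_divided_difference:
  assumes "degree_below (Suc d) f" "s \<in> pseudo_reflections W"
  shows "degree_below d (divided_difference s f)"
  using assms by (intro degree_below_cancel[of d s])
    (simp_all add: divided_difference degree_below_diff degree_below_act reflection_in_W)

end

section \<open>Relations in the tensor square\<close>

lemma tensor_kernel_0: "0 \<in> tensor_kernel A"
  using subgroup.one_closed[OF subgroup_tensor_kernel, of A] by simp

lemma tensor_kernel_add: "c \<in> tensor_kernel A \<Longrightarrow> d \<in> tensor_kernel A \<Longrightarrow> c + d \<in> tensor_kernel A"
  using subgroup.m_closed[OF subgroup_tensor_kernel, of c A d] by simp

lemma tensor_kernel_minus: "c \<in> tensor_kernel A \<Longrightarrow> - c \<in> tensor_kernel A"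
  using subgroup.m_inv_closed[OF subgroup_tensor_kernel, of c A] by simp

lemma tensor_kernel_diff: "c \<in> tensor_kernel A \<Longrightarrow> d \<in> tensor_kernel A \<Longrightarrow> c - d \<in> tensor_kernel A"
  using tensor_kernel_add[of c A "- d"] tensor_kernel_minus[of d A] by simp

lemma tensor_kernel_sum:
  "(\<And>i. i \<in> I \<Longrightarrow> c i \<in> tensor_kernel A) \<Longrightarrow> (\<Sum>i\<in>I. c i) \<in> tensor_kernel A"
  by (induct I rule: infinite_finite_induct) (simp_all add: tensor_kernel_0 tensor_kernel_add)

lemma tensor_kernel_relator: "c \<in> tensor_relators A \<Longrightarrow> c \<in> tensor_kernel A"
  unfolding tensor_kernel_def by (rule generate.incl)

lemma tensor_add_left:
  "frag_of (f + f', g) - frag_of (f, g) - frag_of (f', g) \<in> tensor_kernel A"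
  by (rule tensor_kernel_relator) (unfold tensor_relators_def, blast)

lemma tensor_add_right:
  "frag_of (f, g + g') - frag_of (f, g) - frag_of (f, g') \<in> tensor_kernel A"
  by (rule tensor_kernel_relator) (unfold tensor_relators_def, blast)

lemma tensor_balanced:
  "a \<in> A \<Longrightarrow> frag_of (f * a, g) - frag_of (f, a * g) \<in> tensor_kernel A"
  by (rule tensor_kernel_relator) (unfold tensor_relators_def, blast)

lemma tensor_zero_left: "frag_of (0, g) \<in> tensor_kernel A"
  using tensor_kernel_minus[OF tensor_add_left[of 0 0 g A]] by simp

lemma tensor_zero_right: "frag_of (f, 0) \<in> tensor_kernel A"
  using tensor_kernel_minus[OF tensor_add_right[of f 0 0 A]] by simp

text \<open>An \<open>A\<close>-linear operator on the left factor respects the defining relations of the tensor product.\<close>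

lemma map_left_tensor_kernel:
  assumes c: "c \<in> tensor_kernel A"
    and add: "\<And>f g. \<phi> (f + g) = \<phi> f + \<phi> g" and lin: "\<And>f a. a \<in> A \<Longrightarrow> \<phi> (f * a) = \<phi> f * a"
  shows "map_left \<phi> c \<in> tensor_kernel A"
proof -
  have rel: "map_left \<phi> h \<in> tensor_kernel A" if "h \<in> tensor_relators A" for h
  proof -
    from that consider
        f f' g where "h = frag_of (f + f', g) - frag_of (f, g) - frag_of (f', g)"
      | f g g' where "h = frag_of (f, g + g') - frag_of (f, g) - frag_of (f, g')"
      | f a g where "h = frag_of (f * a, g) - frag_of (f, a * g)" "a \<in> A"
      unfolding tensor_relators_def by blast
    then show ?thesis
      by cases (simp_all add: map_left_diff add lin tensor_add_left tensor_add_right tensor_balanced)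
  qed
  show ?thesis
    using c unfolding tensor_kernel_def
  proof (induction rule: generate.induct)
    case (inv h)
    then show ?case using tensor_kernel_minus[OF rel] by (simp add: map_left_minus tensor_kernel_def)
  qed (use rel tensor_kernel_0 tensor_kernel_add in \<open>simp_all add: map_left_add tensor_kernel_def\<close>)
qed

lemma map_left_sum_diff:
  assumes "finite I"
  shows "map_left (\<lambda>f. \<Sum>i\<in>I. \<phi> i f) c - (\<Sum>i\<in>I. map_left (\<phi> i) c) \<in> tensor_kernel A"
proof (induct c rule: frag_pair_induct)
  case zero
  show ?case by (simp add: tensor_kernel_0)
next
  case (one f g)
  show ?case
    using assms
  proof (induct I rule: finite_induct)
    case empty
    show ?case by (simp add: tensor_zero_left)
  next
    case (insert i I)
    have "(frag_of (\<phi> i f + (\<Sum>i\<in>I. \<phi> i f), g) - frag_of (\<phi> i f, g) - frag_of (\<Sum>i\<in>I. \<phi> i f, g)) +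
        (map_left (\<lambda>f. \<Sum>i\<in>I. \<phi> i f) (frag_of (f, g)) - (\<Sum>i\<in>I. map_left (\<phi> i) (frag_of (f, g))))
        \<in> tensor_kernel A"
      by (rule tensor_kernel_add[OF tensor_add_left insert.hyps(3)])
    then show ?case using insert.hyps by (simp add: algebra_simps)
  qed
next
  case (diff c d)
  then show ?case using tensor_kernel_diff[OF diff] by (simp add: map_left_diff sum_subtractf algebra_simps)
qed

lemma map_left_diff_diff:
  "map_left (\<lambda>f. \<phi> f - \<psi> f) c - (map_left \<phi> c - map_left \<psi> c) \<in> tensor_kernel A"
proof (induct c rule: frag_pair_induct)
  case zero
  show ?case by (simp add: tensor_kernel_0)
next
  case (one f g)
  show ?case
    using tensor_kernel_minus[OF tensor_add_left[of "\<phi> f - \<psi> f" "\<psi> f" g A]] by (simp add: algebra_simps)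
next
  case (diff c d)
  then show ?case using tensor_kernel_diff[OF diff] by (simp add: map_left_diff algebra_simps)
qed

section \<open>Descent along the group action\<close>

context reflection_group
begin

text \<open>The elements of \<open>W\<close> that fix \<open>a\<close> up to \<open>E\<close> form a subgroup. The abstract equivalence
  serves two actions: on tensors modulo the relations and on maps modulo the image.\<close>

lemma generated_stabilizer:
  fixes \<alpha> :: "'a ^ 'n ^ 'n \<Rightarrow> 'm \<Rightarrow> 'm"
  assumes E: "\<And>a. E a a" "\<And>a b. E a b \<Longrightarrow> E b a" "\<And>a b c. E a b \<Longrightarrow> E b c \<Longrightarrow> E a c"
    and one: "\<And>a. \<alpha> \<one>\<^bsub>GL\<^esub> a = a"
    and mult: "\<And>u w a. u \<in> W \<Longrightarrow> w \<in> W \<Longrightarrow> \<alpha> (u \<otimes>\<^bsub>GL\<^esub> w) a = \<alpha> u (\<alpha> w a)"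
    and cong: "\<And>u a b. u \<in> W \<Longrightarrow> E a b \<Longrightarrow> E (\<alpha> u a) (\<alpha> u b)"
    and refl: "\<And>s. s \<in> pseudo_reflections W \<Longrightarrow> E (\<alpha> s a) a"
    and w: "w \<in> W"
  shows "E (\<alpha> w a) a"
proof -
  have "w \<in> generate GL (pseudo_reflections W)" using w by (simp add: generated)
  then show ?thesis
  proof (induction rule: generate.induct)
    case one
    show ?case by (simp add: assms(4) E(1))
  next
    case (incl s)
    then show ?case by (rule refl)
  next
    case (inv s)
    have s: "s \<in> W" using reflection_in_W[OF inv] .
    have "E (\<alpha> (inv\<^bsub>GL\<^esub> s) (\<alpha> s a)) (\<alpha> (inv\<^bsub>GL\<^esub> s) a)" using cong refl[OF inv] s by simp
    moreover have "\<alpha> (inv\<^bsub>GL\<^esub> s) (\<alpha> s a) = a" using s by (simp add: one flip: mult)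
    ultimately show ?case using E(2) by simp
  next
    case (eng u w)
    then have "u \<in> W" "w \<in> W" by (simp_all add: generated)
    then show ?case using cong[of u "\<alpha> w a" a] eng E(3) by (simp add: mult)
  qed
qed

definition average :: "('a, 'n) polyfun \<Rightarrow> ('a, 'n) polyfun" where
  "average f = (\<Sum>w\<in>W. act w (const_fun (inverse (of_nat (card W))) * f))"

lemma sum_scaled_const:
  "(\<Sum>w\<in>W. const_fun (inverse (of_nat (card W))) * f) = (f :: ('a, 'n) polyfun)"
proof -
  have "of_nat (card W) * const_fun (inverse (of_nat (card W))) = (1 :: ('a, 'n) polyfun)"
    using card_W by (simp flip: const_fun_of_nat const_fun_mult)
  then show ?thesis by (simp flip: mult.assoc)
qed

lemma bij_betw_left_translation: "u \<in> W \<Longrightarrow> bij_betw (\<lambda>w. u \<otimes>\<^bsub>GL\<^esub> w) W W"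
  by (rule bij_betwI[of _ _ _ "\<lambda>w. inv\<^bsub>GL\<^esub> u \<otimes>\<^bsub>GL\<^esub> w"]) (auto simp: GL.m_assoc[symmetric])

lemma average_invariant: "average f \<in> invariants W"
  unfolding invariants_def
proof (intro CollectI ballI)
  fix u assume u: "u \<in> W"
  let ?f = "const_fun (inverse (of_nat (card W))) * f"
  have "act u (average f) = (\<Sum>w\<in>W. act (u \<otimes>\<^bsub>GL\<^esub> w) ?f)"
    using u by (simp add: average_def act_sum act_act)
  also have "\<dots> = (\<Sum>w\<in>W. act w ?f)"
    by (rule sum.reindex_bij_betw[OF bij_betw_left_translation[OF u]])
  finally show "act u (average f) = average f" by (simp add: average_def)
qed

text \<open>Averages are invariant, so they can be moved across the tensor sign: \<open>average f \<otimes> g = 1 \<otimes> average f g\<close>.\<close>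

lemma map_left_average_pure:
  "\<exists>h. map_left average c - frag_of (1, h) \<in> tensor_kernel (invariants W)"
proof (induct c rule: frag_pair_induct)
  case zero
  show ?case by (rule exI[of _ 0]) (simp add: tensor_zero_right tensor_kernel_minus)
next
  case (one f g)
  show ?case using tensor_balanced[OF average_invariant, of 1 f g] by auto
next
  case (diff c d)
  then obtain h k where hk: "map_left average c - frag_of (1, h) \<in> tensor_kernel (invariants W)"
    "map_left average d - frag_of (1, k) \<in> tensor_kernel (invariants W)" by blast
  have "(map_left average c - frag_of (1, h)) - (map_left average d - frag_of (1, k)) +
      (frag_of (1, (h - k) + k) - frag_of (1, h - k) - frag_of (1, k)) \<in> tensor_kernel (invariants W)"
    by (intro tensor_kernel_add tensor_kernel_diff hk tensor_add_right)
  then show ?case by (intro exI[of _ "h - k"]) (simp add: map_left_diff algebra_simps)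
qed

lemma map_left_act_tensor_kernel:
  "w \<in> W \<Longrightarrow> c \<in> tensor_kernel (invariants W) \<Longrightarrow> map_left (act w) c \<in> tensor_kernel (invariants W)"
  by (rule map_left_tensor_kernel) (auto simp: act_add act_mult invariants_def)

lemma map_left_scale_tensor_kernel:
  "c \<in> tensor_kernel (invariants W) \<Longrightarrow> map_left ((*) p) c \<in> tensor_kernel (invariants W)"
  by (rule map_left_tensor_kernel) (auto simp: algebra_simps)

lemma map_left_average_diff:
  assumes inv: "\<And>w. w \<in> W \<Longrightarrow> map_left (act w) c - c \<in> tensor_kernel (invariants W)"
  shows "map_left average c - c \<in> tensor_kernel (invariants W)"
proof -
  let ?k = "const_fun (inverse (of_nat (card W))) :: ('a, 'n) polyfun"
  let ?c = "map_left ((*) ?k) c"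
  have "map_left (\<lambda>f. act w (?k * f)) c - ?c \<in> tensor_kernel (invariants W)" if "w \<in> W" for w
  proof -
    have "map_left ((*) ?k) (map_left (act w) c - c) \<in> tensor_kernel (invariants W)"
      by (rule map_left_scale_tensor_kernel[OF inv[OF that]])
    then show ?thesis by (simp add: map_left_diff map_left_map_left act_mult)
  qed
  then have 1: "(\<Sum>w\<in>W. map_left (\<lambda>f. act w (?k * f)) c - ?c) \<in> tensor_kernel (invariants W)"
    by (rule tensor_kernel_sum)
  have 2: "map_left average c - (\<Sum>w\<in>W. map_left (\<lambda>f. act w (?k * f)) c) \<in> tensor_kernel (invariants W)"
    using map_left_sum_diff[OF finite_W, of "\<lambda>w f. act w (?k * f)" c]
    by (simp add: average_def[abs_def])
  have 3: "c - (\<Sum>w\<in>W. ?c) \<in> tensor_kernel (invariants W)"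
    using map_left_sum_diff[OF finite_W, of "\<lambda>w f. ?k * f" c] unfolding sum_scaled_const map_left_id .
  from tensor_kernel_diff[OF tensor_kernel_add[OF 1 2] 3] show ?thesis
    by (simp add: sum_subtractf algebra_simps)
qed

text \<open>Induction on the degree of the left factors. The image of \<open>c\<close> under \<open>\<Delta>\<^sub>s \<otimes> 1\<close> is again in the kernel, so
  it vanishes by induction, and \<open>c\<close> is \<open>s\<close>-invariant for all \<open>s\<close>. Hence \<open>c\<close> equals its average, a pure
  tensor \<open>1 \<otimes> h\<close>, whose image at the identity of \<open>W\<close> is \<open>h\<close>.\<close>

lemma localization_lift_injective:
  assumes "\<And>x. x \<in> W \<Longrightarrow> localization_lift W c x = 0"
    and "\<And>f g. (f, g) \<in> Poly_Mapping.keys c \<Longrightarrow> degree_below d f"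
  shows "c \<in> tensor_kernel (invariants W)"
  using assms
proof (induction d arbitrary: c)
  case 0
  have "Poly_Mapping.keys c \<subseteq> {0} \<times> UNIV" using 0(2) degree_below_0 by auto
  then show ?case
    by (induct c rule: frag_induction) (auto simp: tensor_kernel_0 tensor_zero_left tensor_kernel_diff)
next
  case (Suc d)
  have step: "map_left (act s) c - c \<in> tensor_kernel (invariants W)" if s: "s \<in> pseudo_reflections W" for s
  proof -
    let ?D = "map_left (divided_difference s) c"
    have "?D \<in> tensor_kernel (invariants W)"
    proof (rule Suc.IH)
      fix x assume x: "x \<in> W"
      have "l s * localization_lift W ?D x = 0"
        using Suc.prems(1) x reflection_in_W[OF s] by (simp add: localization_lift_divided_difference[OF s])
      then show "localization_lift W ?D x = 0" using coroot_nonzero[OF s] by simp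
    next
      fix f g assume "(f, g) \<in> Poly_Mapping.keys ?D"
      then obtain f' where "f = divided_difference s f'" "(f', g) \<in> Poly_Mapping.keys c"
        using keys_map_left[of "divided_difference s" c] by auto
      then show "degree_below d f" using degree_below_divided_difference[OF Suc.prems(2) s] by simp
    qed
    then have "map_left ((*) (l s)) ?D \<in> tensor_kernel (invariants W)"
      by (rule map_left_scale_tensor_kernel)
    then have "map_left (\<lambda>f. act s f - f) c \<in> tensor_kernel (invariants W)"
      by (simp add: map_left_map_left divided_difference[OF s])
    from tensor_kernel_diff[OF this map_left_diff_diff[of "act s" "\<lambda>f. f" c]]
    show ?thesis by (simp add: map_left_id)
  qed
  have inv: "map_left (act w) c - c \<in> tensor_kernel (invariants W)" if "w \<in> W" for w
  proof (rule generated_stabilizer[where E = "\<lambda>a b. a - b \<in> tensor_kernel (invariants W)"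
        and \<alpha> = "\<lambda>w. map_left (act w)", OF _ _ _ _ _ _ step that])
    fix a b c :: "('a, 'n) polyfun \<times> ('a, 'n) polyfun \<Rightarrow>\<^sub>0 int"
    show "a - a \<in> tensor_kernel (invariants W)" by (simp add: tensor_kernel_0)
    show "b - a \<in> tensor_kernel (invariants W)" if "a - b \<in> tensor_kernel (invariants W)"
      using tensor_kernel_minus[OF that] by simp
    show "a - c \<in> tensor_kernel (invariants W)"
      if "a - b \<in> tensor_kernel (invariants W)" "b - c \<in> tensor_kernel (invariants W)"
      using tensor_kernel_add[OF that] by simp
    show "map_left (act \<one>\<^bsub>GL\<^esub>) a = a" by (simp add: act_one[abs_def] map_left_id)
    show "map_left (act (u \<otimes>\<^bsub>GL\<^esub> w)) a = map_left (act u) (map_left (act w) a)"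
      if "u \<in> W" "w \<in> W" for u w
    proof -
      have "act (u \<otimes>\<^bsub>GL\<^esub> w) = (\<lambda>f. act u (act w f))" using that by (intro ext act_act) simp_all
      then show ?thesis by (simp add: map_left_map_left)
    qed
    show "map_left (act u) a - map_left (act u) b \<in> tensor_kernel (invariants W)"
      if "u \<in> W" "a - b \<in> tensor_kernel (invariants W)" for u
      using map_left_act_tensor_kernel[OF that] by (simp add: map_left_diff)
  qed
  obtain h where h: "map_left average c - frag_of (1, h) \<in> tensor_kernel (invariants W)"
    using map_left_average_pure by blast
  \<comment> \<open>At this point \<open>c = 1 \<otimes> h\<close> in the tensor product, so evaluating at the identity gives \<open>h\<close>.\<close>
  have ch: "c - frag_of (1, h) \<in> tensor_kernel (invariants W)"
    using tensor_kernel_diff[OF h map_left_average_diff[OF inv]] by simp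
  have "localization_lift W c \<one>\<^bsub>GL\<^esub> - h = 0"
    using localization_lift_tensor_kernel[OF ch one_in_W]
    by (simp add: localization_lift_diff localization_lift_frag_of)
  then have "h = 0" using Suc.prems(1) by simp
  then show ?case using tensor_kernel_add[OF ch tensor_zero_right[of 1]] by simp
qed

text \<open>Induction on the degree of the values of \<open>F\<close>. The map \<open>(sF - F) / l\<^sub>s\<close> is in the image by induction, hence
  so is \<open>sF - F\<close>, and \<open>F\<close> is \<open>W\<close>-invariant modulo the image. The average of the translates of \<open>F\<close> sends
  \<open>x\<close> to \<open>x(h)\<close>, where \<open>h\<close> is its value at the identity.\<close>

lemma localization_lift_onto:
  assumes "locally_tensor F" and "\<And>x. x \<in> W \<Longrightarrow> degree_below d (F x)"
  shows "\<exists>c. \<forall>x\<in>W. F x = localization_lift W c x"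
  using assms
proof (induction d arbitrary: F)
  case 0
  then have "F x = 0" if "x \<in> W" for x using that degree_below_0 by simp
  then show ?case by (intro exI[of _ 0]) (simp add: localization_lift_0)
next
  case (Suc d)
  define E where "E a b \<longleftrightarrow> (\<exists>c. \<forall>x\<in>W. a x - b x = localization_lift W c x)"
    for a b :: "'a ^ 'n ^ 'n \<Rightarrow> ('a, 'n) polyfun"
  define \<alpha> where "\<alpha> w a = (\<lambda>x. act w (a (inv\<^bsub>GL\<^esub> w \<otimes>\<^bsub>GL\<^esub> x)))"
    for w and a :: "'a ^ 'n ^ 'n \<Rightarrow> ('a, 'n) polyfun"
  have step: "E (\<alpha> s F) F" if s: "s \<in> pseudo_reflections W" for s
  proof -
    obtain G where G: "\<And>x. x \<in> W \<Longrightarrow> l s * G x = act s (F (inv\<^bsub>GL\<^esub> s \<otimes>\<^bsub>GL\<^esub> x)) - F x"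
      using locally_tensor_divided_difference_exists[OF Suc.prems(1) s] by blast
    have "\<exists>c. \<forall>x\<in>W. G x = localization_lift W c x"
    proof (rule Suc.IH)
      show "locally_tensor G" by (rule locally_tensor_divided_difference[OF Suc.prems(1) s G])
      show "degree_below d (G x)" if "x \<in> W" for x
        using that Suc.prems(2) reflection_in_W[OF s]
        by (intro degree_below_cancel[of d s]) (simp_all add: s G degree_below_diff degree_below_act)
    qed
    then obtain c where "\<forall>x\<in>W. G x = localization_lift W c x" by blast
    then show ?thesis unfolding E_def \<alpha>_def
      by (intro exI[of _ "map_left ((*) (l s)) c"]) (simp add: localization_lift_scale G[symmetric])
  qed
  have inv: "E (\<alpha> w F) F" if "w \<in> W" for w
  proof (rule generated_stabilizer[where E = E and \<alpha> = \<alpha>, OF _ _ _ _ _ _ step that])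
    fix a b c :: "'a ^ 'n ^ 'n \<Rightarrow> ('a, 'n) polyfun"
    show "E a a" unfolding E_def by (rule exI[of _ 0]) (simp add: localization_lift_0)
    show "E b a" if ab: "E a b"
    proof -
      obtain d where "\<forall>x\<in>W. a x - b x = localization_lift W d x" using ab by (auto simp: E_def)
      then have "b x - a x = localization_lift W (- d) x" if "x \<in> W" for x
        using that by (metis localization_lift_minus minus_diff_eq)
      then show ?thesis unfolding E_def by blast
    qed
    show "E a c" if abc: "E a b" "E b c"
    proof -
      obtain d d' where d: "\<forall>x\<in>W. a x - b x = localization_lift W d x"
        "\<forall>x\<in>W. b x - c x = localization_lift W d' x" using abc by (auto simp: E_def)
      have "a x - c x = localization_lift W (d + d') x" if "x \<in> W" for x
        using that by (simp add: localization_lift_add d[rule_format, symmetric])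
      then show ?thesis unfolding E_def by blast
    qed
    show "\<alpha> \<one>\<^bsub>GL\<^esub> a = a"
      by (simp add: \<alpha>_def fun_eq_iff) (simp add: GL_def)
    show "\<alpha> (u \<otimes>\<^bsub>GL\<^esub> w) a = \<alpha> u (\<alpha> w a)" if "u \<in> W" "w \<in> W" for u w
      using that by (simp add: \<alpha>_def fun_eq_iff act_act GL.inv_mult_group)
        (simp add: GL_def matrix_mul_assoc)
    show "E (\<alpha> u a) (\<alpha> u b)" if u: "u \<in> W" and "E a b" for u
    proof -
      obtain d where "\<forall>x\<in>W. a x - b x = localization_lift W d x" using \<open>E a b\<close> by (auto simp: E_def)
      then have "\<alpha> u a x - \<alpha> u b x = localization_lift W (map_left (act u) d) x" if "x \<in> W" for x
        using u that by (simp add: \<alpha>_def localization_lift_act flip: act_diff)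
      then show ?thesis unfolding E_def by blast
    qed
  qed
  then obtain c where c: "\<And>w x. w \<in> W \<Longrightarrow> x \<in> W \<Longrightarrow> \<alpha> w F x - F x = localization_lift W (c w) x"
    unfolding E_def by metis
  let ?k = "const_fun (inverse (of_nat (card W))) :: ('a, 'n) polyfun"
  define h where "h = (\<Sum>w\<in>W. ?k * \<alpha> w F \<one>\<^bsub>GL\<^esub>)"
  have "F x = localization_lift W (frag_of (1, h) - (\<Sum>w\<in>W. map_left ((*) ?k) (c w))) x"
    if x: "x \<in> W" for x
  proof -
    \<comment> \<open>Substituting \<open>w \<mapsto> x w\<close> identifies \<open>x(h)\<close> with the value at \<open>x\<close> of the average of the translates.\<close>
    have "act x h = (\<Sum>w\<in>W. ?k * act (x \<otimes>\<^bsub>GL\<^esub> w) (F (inv\<^bsub>GL\<^esub> (x \<otimes>\<^bsub>GL\<^esub> w) \<otimes>\<^bsub>GL\<^esub> x)))"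
      using x by (simp add: h_def \<alpha>_def act_sum act_mult act_act GL.inv_mult_group GL.m_assoc)
    also have "\<dots> = (\<Sum>w\<in>W. ?k * \<alpha> w F x)"
      unfolding \<alpha>_def
      by (rule sum.reindex_bij_betw[OF bij_betw_left_translation[OF x],
            of "\<lambda>w. ?k * act w (F (inv\<^bsub>GL\<^esub> w \<otimes>\<^bsub>GL\<^esub> x))"])
    finally have "act x h - (\<Sum>w\<in>W. ?k * (\<alpha> w F x - F x)) = (\<Sum>w\<in>W. ?k * F x)"
      by (simp add: right_diff_distrib sum_subtractf)
    also have "\<dots> = F x" by (rule sum_scaled_const)
    finally show ?thesis
      using x by (simp add: localization_lift_diff localization_lift_frag_of localization_lift_sum
          localization_lift_scale c)
  qed
  then show ?case by blast
qed

text \<open>On the coset \<open>W\<^sub>m x\<close> the tensor \<open>f \<otimes> g\<close> acts as \<open>f \<otimes> x(g)\<close>, as \<open>(w x)(g) = w(x(g))\<close>.\<close>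

lemma locally_tensor_localization_lift: "locally_tensor (localization_lift W c)"
  unfolding locally_tensor_def
proof (intro allI impI ballI)
  fix m :: "('a, 'n) polyfun" and x assume x: "x \<in> W"
  show "\<exists>d. \<forall>w\<in>fixing_subgroup m.
      localization_lift W c (w \<otimes>\<^bsub>GL\<^esub> x) = localization_lift (fixing_subgroup m) d w"
  proof (induct c rule: frag_pair_induct)
    case zero
    show ?case
      using x by (intro exI[of _ 0]) (simp add: localization_lift_0 fixing_subgroup_in_W)
  next
    case (one f g)
    show ?case
      using x by (intro exI[of _ "frag_of (f, act x g)"])
        (simp add: localization_lift_frag_of fixing_subgroup_in_W act_act)
  next
    case (diff c d)
    then obtain c' d' where
      "\<forall>w\<in>fixing_subgroup m. localization_lift W c (w \<otimes>\<^bsub>GL\<^esub> x) = localization_lift (fixing_subgroup m) c' w"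
      "\<forall>w\<in>fixing_subgroup m. localization_lift W d (w \<otimes>\<^bsub>GL\<^esub> x) = localization_lift (fixing_subgroup m) d' w"
      by blast
    then show ?case
      using x by (intro exI[of _ "c' - d'"]) (simp add: localization_lift_diff fixing_subgroup_in_W)
  qed
qed

lemma uniform_degree_bound:
  assumes "finite X"
  shows "\<exists>d. \<forall>x\<in>X. degree_below d (F x)"
  using assms
proof (induct X rule: finite_induct)
  case (insert x X)
  then obtain d d' where "\<forall>x\<in>X. degree_below d (F x)" "degree_below d' (F x)"
    using degree_below_exists by blast
  then have "\<forall>y\<in>insert x X. degree_below (max d d') (F y)"
    using degree_below_mono by (metis insertE max.cobounded1 max.cobounded2)
  then show ?case by blast
qed simp

theorem localization_map_inj:
  "inj_on (localization_map W) (carrier (tensor_square (invariants W)))"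
proof (rule inj_onI)
  let ?N = "tensor_kernel (invariants W)"
  fix S T
  assume "S \<in> carrier (tensor_square (invariants W))" "T \<in> carrier (tensor_square (invariants W))"
    and eq: "localization_map W S = localization_map W T"
  then obtain a b where S: "S = ?N #>\<^bsub>free_Abelian_group UNIV\<^esub> a" and T: "T = ?N #>\<^bsub>free_Abelian_group UNIV\<^esub> b"
    by (auto simp: tensor_square_def FactGroup_def RCOSETS_def)
  have "localization_lift W (a - b) x = 0" if "x \<in> W" for x
    using that eq by (simp add: S T localization_map_coset localization_lift_diff)
  moreover obtain d where "\<forall>q\<in>Poly_Mapping.keys (a - b). degree_below d (fst q)"
    using uniform_degree_bound[of "Poly_Mapping.keys (a - b)" fst] by auto
  ultimately have "a - b \<in> ?N"
    by (intro localization_lift_injective[of "a - b" d]) auto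
  then have "a \<in> ?N #>\<^bsub>free_Abelian_group UNIV\<^esub> b" by (force simp: r_coset_def)
  then show "S = T"
    unfolding S T by (intro group.repr_independence[symmetric] subgroup_tensor_kernel) auto
qed

theorem localization_map_image:
  "localization_map W ` carrier (tensor_square (invariants W)) = H_set W l"
proof -
  have carrier: "carrier (tensor_square (invariants W)) =
      range (\<lambda>c. tensor_kernel (invariants W) #>\<^bsub>free_Abelian_group UNIV\<^esub> c)"
    by (auto simp: tensor_square_def FactGroup_def RCOSETS_def)
  have "localization_map W ` carrier (tensor_square (invariants W)) = range (localization_lift W)"
    unfolding carrier by (simp add: image_image localization_map_coset)
  also have "\<dots> = {F. F \<in> W \<rightarrow>\<^sub>E UNIV \<and> locally_tensor F}"
  proof (intro equalityI subsetI)
    fix F assume "F \<in> range (localization_lift W)"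
    then show "F \<in> {F. F \<in> W \<rightarrow>\<^sub>E UNIV \<and> locally_tensor F}"
      using locally_tensor_localization_lift by (auto simp: localization_lift_def)
  next
    fix F assume F: "F \<in> {F. F \<in> W \<rightarrow>\<^sub>E UNIV \<and> locally_tensor F}"
    obtain d where "\<forall>x\<in>W. degree_below d (F x)" using uniform_degree_bound[OF finite_W] by blast
    then obtain c where c: "\<forall>x\<in>W. F x = localization_lift W c x"
      using localization_lift_onto[of F d] F by blast
    have "F = localization_lift W c"
    proof
      fix x show "F x = localization_lift W c x"
      proof (cases "x \<in> W")
        case False
        then have "F x = undefined" using F PiE_arb by fast
        then show ?thesis using False by (simp add: localization_lift_def)
      qed (use c in blast)
    qed
    then show "F \<in> range (localization_lift W)" by simp
  qed
  also have "\<dots> = H_set W l" using H_set_iff_locally_tensor[OF coroot] by auto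
  finally show ?thesis .
qed

end

theorem theorem1p1:
  fixes W :: "('a::alg_closed_field ^ 'n::finite ^ 'n) set"
    and l :: "'a ^ 'n ^ 'n \<Rightarrow> ('a, 'n) polyfun"
  assumes "subgroup W GL"
    and "finite W"
    and "generate GL (pseudo_reflections W) = W"
    and "(of_nat (card W) :: 'a) \<noteq> 0"
    and "\<And>s. s \<in> pseudo_reflections W \<Longrightarrow> is_coroot s (l s)"
  shows "inj_on (localization_map W) (carrier (tensor_square (invariants W))) \<and>
    localization_map W ` carrier (tensor_square (invariants W)) = H_set W l"
proof -
  interpret reflection_group W l
    using assms
    by (intro reflection_group.intro finite_linear_group.intro reflection_group_axioms.intro)
  show ?thesis using localization_map_inj localization_map_image ..
qed

end
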